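(* Let $\Gamma$ be a finite simple graph and $G=G(\Gamma)$. The following are equivalent (where $\rtimes$ denotes internal semi-direct product, with the first factor normal). (i) $\operatorname{Dom}(\Gamma)=\emptyset$, i.e. $\Gamma$ has no dominated vertices. (ii) $\operatorname{St}^{\operatorname{conj}}(\mathcal{K})=\operatorname{Conj}_{\operatorname{N}}(G)\rtimes \operatorname{St}(\mathcal{L})$. (iii) $\operatorname{St}^{\operatorname{conj}}(\mathcal{K})=\operatorname{Conj}(G)\rtimes \operatorname{St}(\mathcal{L})$. (iv) $\operatorname{St}^{\operatorname{conj}}(\mathcal{K})=\operatorname{Conj}(G)\rtimes \operatorname{St}(\mathcal{K})$.
   Context: $\Gamma$ is a finite, undirected, simple graph with vertex set $X$. The partially commutative group $G=G(\Gamma)$ has presentation $\langle X\mid [x,y]=1 \text{ whenever } x,y\in X \text{ are joined by an edge of }\Gamma\rangle$. For $Y\subseteq X$, $G(Y)$ is the subgroup of $G$ generated by $Y$. Conventions: automorphisms act on the right; $g^h=h^{-1}gh$ and $H^h=h^{-1}Hh$. For $Y\subseteq X$, $Y^\perp=\{u\in X: d(u,y)\le 1 \text{ for all } y\in Y\}$ ($d$ the graph distance), $\emptyset^\perp=X$, $x^\perp=\{x\}^\perp$, and $x^\perp\backslash x$ means $x^\perp\backslash\{x\}$. Closed sets: $\operatorname{cl}(Y)=(Y^\perp)^\perp$; $\mathcal{L}$ is the set of all $Y\subseteq X$ with $Y=\operatorname{cl}(Y)$. Admissible sets: $\mathfrak{a}(\emptyset)=X$ and, for $\emptyset\ne Y\subseteq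 X$, $\mathfrak{a}(Y)=\bigcap_{y\in Y}(y^\perp\backslash y)^\perp$; $\mathfrak{a}(x)=\mathfrak{a}(\{x\})$; $\mathcal{K}=\{\mathfrak{a}(Y):Y\subseteq X\}$. A vertex $x$ dominates a vertex $y$ if $x^\perp\cap y^\perp=y^\perp\backslash y$. $\operatorname{Dom}(\Gamma)$ is the set of all vertices $y\in X$ dominated by some $x\in X$. $\operatorname{St}(\mathcal{L})=\{\phi\in\operatorname{Aut}(G): G(Y)\phi=G(Y)\text{ for all }Y\in\mathcal{L}\}$; $\operatorname{St}(\mathcal{K})=\{\phi\in\operatorname{Aut}(G): G(Y)\phi=G(Y)\text{ for all }Y\in\mathcal{K}\}$; $\operatorname{St}^{\operatorname{conj}}(\mathcal{K})$ is the group of all $\phi\in\operatorname{Aut}(G)$ such that for every $Y\in\mathcal{K}$ there is $f_Y\in G$ with $G(Y)\phi=G(Y)^{f_Y}$. $\operatorname{Conj}(G)$ is the group of all $\phi\in\operatorname{Aut}(G)$ such that for every $x\in X$ there is $g_x\in G$ with $x\phi=x^{g_x}$. $\operatorname{Conj}_{\operatorname{N}}(G)$ is the subgroup of those $\phi\in\operatorname{Conj}(G)$ such that for every $x\in X$ there exists $f_x\in G$ with $y\phi=y^{f_x}$ for all $y\in\mathfrak{a}(x)$. *)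

theory Defs
  imports
    "HOL-Algebra.Bij"
    "HOL-Algebra.Generated_Groups"
    "Graph_Theory.Pair_Digraph"
    "Graph_Theory.Shortest_Path"
begin

section \<open>Group presentations\<close>

text \<open>A letter \<^term>\<open>(x, True)\<close> stands for the generator \<^term>\<open>x\<close>, a letter
  \<^term>\<open>(x, False)\<close> for its formal inverse.\<close>

type_synonym 'a word = "('a \<times> bool) list"

definition words :: "'a set \<Rightarrow> 'a word set" where
  "words X = lists (X \<times> UNIV)"

inductive_set pres_cong :: "'a set \<Rightarrow> 'a word set \<Rightarrow> 'a word rel"
  for X :: "'a set" and R :: "'a word set" where
  refl: "u \<in> words X \<Longrightarrow> (u, u) \<in> pres_cong X R"
| sym: "(u, v) \<in> pres_cong X R \<Longrightarrow> (v, u) \<in> pres_cong X R"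
| trans: "(u, v) \<in> pres_cong X R \<Longrightarrow> (v, w) \<in> pres_cong X R \<Longrightarrow> (u, w) \<in> pres_cong X R"
| cancel: "u \<in> words X \<Longrightarrow> v \<in> words X \<Longrightarrow> x \<in> X \<Longrightarrow>
    (u @ [(x, b), (x, \<not> b)] @ v, u @ v) \<in> pres_cong X R"
| relator: "u \<in> words X \<Longrightarrow> v \<in> words X \<Longrightarrow> r \<in> R \<Longrightarrow>
    (u @ r @ v, u @ v) \<in> pres_cong X R"

text \<open>The group \<open>\<langle>X | r = 1 for r \<in> R\<rangle>\<close>; meaningful if \<^prop>\<open>R \<subseteq> words X\<close>.\<close>

definition pres_group :: "'a set \<Rightarrow> 'a word set \<Rightarrow> 'a word set monoid" where
  "pres_group X R =
    \<lparr>carrier = words X // pres_cong X R,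
     monoid.mult = (\<lambda>A B. \<Union>u\<in>A. \<Union>v\<in>B. pres_cong X R `` {u @ v}),
     monoid.one = pres_cong X R `` {[]}\<rparr>"

definition pres_gen :: "'a set \<Rightarrow> 'a word set \<Rightarrow> 'a \<Rightarrow> 'a word set" where
  "pres_gen X R x = pres_cong X R `` {[(x, True)]}"

lemma pres_cong_words:
  assumes "R \<subseteq> words X" "(u, v) \<in> pres_cong X R"
  shows "u \<in> words X \<and> v \<in> words X"
  using assms(2,1) by induction (auto simp: words_def)

lemma equiv_pres_cong:
  assumes "R \<subseteq> words X"
  shows "equiv (words X) (pres_cong X R)"
  using pres_cong_words[OF assms]
  by (intro equivI refl_onI symI transI) (auto intro: pres_cong.intros)

lemma pres_cong_append:
  assumes R: "R \<subseteq> words X" and "(u, u') \<in> pres_cong X R" "(v, v') \<in> pres_cong X R"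
  shows "(u @ v, u' @ v') \<in> pres_cong X R"
proof -
  have 1: "(u @ w, u' @ w) \<in> pres_cong X R" if "w \<in> words X" for w
    using assms(2)
  proof induction
    case (cancel u v x b)
    have "v @ w \<in> words X" using cancel that by (auto simp: words_def)
    from pres_cong.cancel[OF cancel(1) this cancel(3)] show ?case by simp
  next
    case (relator u v r)
    have "v @ w \<in> words X" using relator that by (auto simp: words_def)
    from pres_cong.relator[OF relator(1) this relator(3)] show ?case by simp
  qed (use that in \<open>auto intro: pres_cong.intros simp: words_def\<close>)
  have 2: "(w @ v, w @ v') \<in> pres_cong X R" if "w \<in> words X" for w
    using assms(3)
  proof induction
    case (cancel u v x b)
    have "w @ u \<in> words X" using cancel that by (auto simp: words_def)
    from pres_cong.cancel[OF this cancel(2,3)] show ?case by simp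
  next
    case (relator u v r)
    have "w @ u \<in> words X" using relator that by (auto simp: words_def)
    from pres_cong.relator[OF this relator(2,3)] show ?case by simp
  qed (use that in \<open>auto intro: pres_cong.intros simp: words_def\<close>)
  show ?thesis
    using 1 2 pres_cong_words[OF R] assms(2,3) by (blast intro: pres_cong.trans)
qed

lemma group_pres_group:
  assumes R: "R \<subseteq> words X"
  shows "group (pres_group X R)"
proof -
  let ?E = "pres_cong X R" and ?G = "pres_group X R"
  note eq = equiv_pres_cong[OF R]
  have cls: "?E `` {u} \<in> carrier ?G" if "u \<in> words X" for u
    using that by (simp add: pres_group_def quotientI)
  have mult: "?E `` {u} \<otimes>\<^bsub>?G\<^esub> ?E `` {v} = ?E `` {u @ v}"
    if "u \<in> words X" "v \<in> words X" for u v
  proof -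
    have "(\<lambda>u v. ?E `` {u @ v}) respects2 ?E"
      by (intro congruent2I') (use pres_cong_append[OF R] eq in \<open>auto intro!: equiv_class_eq\<close>)
    from UN_equiv_class2[OF eq eq this that] show ?thesis by (simp add: pres_group_def)
  qed
  have inv: "\<exists>v\<in>words X. (v @ u, []) \<in> ?E" if "u \<in> words X" for u
    using that
  proof (induction u)
    case Nil
    then show ?case by (auto intro!: bexI[of _ "[]"] pres_cong.refl)
  next
    case (Cons a u)
    obtain x b where a: "a = (x, b)" by force
    from Cons obtain v where v: "v \<in> words X" "(v @ u, []) \<in> ?E" "u \<in> words X" "x \<in> X"
      by (auto simp: words_def a)
    then have "((v @ [(x, \<not> b)]) @ a # u, v @ u) \<in> ?E"
      using pres_cong.cancel[of v X u x "\<not> b" R] by (simp add: a)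
    then show ?case
      using v by (intro bexI[of _ "v @ [(x, \<not> b)]"]) (auto intro: pres_cong.trans simp: words_def)
  qed
  show ?thesis
  proof (rule groupI)
    have one: "\<one>\<^bsub>?G\<^esub> = ?E `` {[]}" "[] \<in> words X"
      by (simp_all add: pres_group_def words_def)
    show "\<one>\<^bsub>?G\<^esub> \<in> carrier ?G" using one cls by simp
    fix A assume "A \<in> carrier ?G"
    then obtain u where u: "u \<in> words X" "A = ?E `` {u}"
      by (auto simp: pres_group_def elim: quotientE)
    show "\<one>\<^bsub>?G\<^esub> \<otimes>\<^bsub>?G\<^esub> A = A" using u one mult by simp
    obtain v where v: "v \<in> words X" "(v @ u, []) \<in> ?E" using inv u by blast
    then have "?E `` {v} \<otimes>\<^bsub>?G\<^esub> A = \<one>\<^bsub>?G\<^esub>"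
      using u one mult equiv_class_eq[OF eq] by simp
    then show "\<exists>B\<in>carrier ?G. B \<otimes>\<^bsub>?G\<^esub> A = \<one>\<^bsub>?G\<^esub>" using cls v by blast
    fix B assume "B \<in> carrier ?G"
    then obtain v where v: "v \<in> words X" "B = ?E `` {v}"
      by (auto simp: pres_group_def elim: quotientE)
    have uv: "u @ v \<in> words X" using u v by (simp add: words_def)
    show "A \<otimes>\<^bsub>?G\<^esub> B \<in> carrier ?G" using u v uv mult cls by simp
    fix C assume "C \<in> carrier ?G"
    then obtain w where w: "w \<in> words X" "C = ?E `` {w}"
      by (auto simp: pres_group_def elim: quotientE)
    then have "v @ w \<in> words X" using v by (simp add: words_def)
    then show "A \<otimes>\<^bsub>?G\<^esub> B \<otimes>\<^bsub>?G\<^esub> C = A \<otimes>\<^bsub>?G\<^esub> (B \<otimes>\<^bsub>?G\<^esub> C)"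
      using u v w uv mult by simp
  qed
qed


section \<open>Partially commutative groups\<close>

text \<open>A finite simple graph is a \<^term>\<open>\<Gamma>\<close> with \<^prop>\<open>pair_graph \<Gamma>\<close>: finite, without loops, and
  with a symmetric set of arcs, an edge being a pair of opposite arcs.\<close>

definition pc_relators :: "'a pair_pre_digraph \<Rightarrow> 'a word set" where
  "pc_relators \<Gamma> = {[(x, False), (y, False), (x, True), (y, True)] |x y. (x, y) \<in> parcs \<Gamma>}"

definition pc_group :: "'a pair_pre_digraph \<Rightarrow> 'a word set monoid" where
  "pc_group \<Gamma> = pres_group (pverts \<Gamma>) (pc_relators \<Gamma>)"

definition pc_gen :: "'a pair_pre_digraph \<Rightarrow> 'a \<Rightarrow> 'a word set" where
  "pc_gen \<Gamma> x = pres_gen (pverts \<Gamma>) (pc_relators \<Gamma>) x"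

definition pc_sub :: "'a pair_pre_digraph \<Rightarrow> 'a set \<Rightarrow> 'a word set set" where
  "pc_sub \<Gamma> Y = generate (pc_group \<Gamma>) (pc_gen \<Gamma> ` Y)"

lemma group_pc_group:
  assumes "pair_graph \<Gamma>"
  shows "group (pc_group \<Gamma>)"
proof -
  interpret pair_graph \<Gamma> by fact
  show ?thesis
    unfolding pc_group_def
    by (rule group_pres_group) (auto simp: pc_relators_def words_def dest: in_arcsD1 in_arcsD2)
qed

definition conjugate :: "('g, 'm) monoid_scheme \<Rightarrow> 'g \<Rightarrow> 'g \<Rightarrow> 'g" where
  "conjugate G g h = inv\<^bsub>G\<^esub> h \<otimes>\<^bsub>G\<^esub> g \<otimes>\<^bsub>G\<^esub> h"

definition conjugate_set :: "('g, 'm) monoid_scheme \<Rightarrow> 'g set \<Rightarrow> 'g \<Rightarrow> 'g set" where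
  "conjugate_set G H h = (\<lambda>g. conjugate G g h) ` H"


section \<open>Closed sets, admissible sets, domination\<close>

definition graph_dist :: "'a pair_pre_digraph \<Rightarrow> 'a \<Rightarrow> 'a \<Rightarrow> ereal" where
  "graph_dist \<Gamma> u v = wf_digraph.\<mu> (with_proj \<Gamma>) (\<lambda>_. 1) u v"

definition perp :: "'a pair_pre_digraph \<Rightarrow> 'a set \<Rightarrow> 'a set" where
  "perp \<Gamma> Y = {u \<in> pverts \<Gamma>. \<forall>y\<in>Y. graph_dist \<Gamma> u y \<le> 1}"

definition cl :: "'a pair_pre_digraph \<Rightarrow> 'a set \<Rightarrow> 'a set" where
  "cl \<Gamma> Y = perp \<Gamma> (perp \<Gamma> Y)"

definition closed_sets :: "'a pair_pre_digraph \<Rightarrow> 'a set set" where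
  "closed_sets \<Gamma> = {Y. Y \<subseteq> pverts \<Gamma> \<and> Y = cl \<Gamma> Y}"

definition adm :: "'a pair_pre_digraph \<Rightarrow> 'a set \<Rightarrow> 'a set" where
  "adm \<Gamma> Y = (if Y = {} then pverts \<Gamma> else (\<Inter>y\<in>Y. perp \<Gamma> (perp \<Gamma> {y} - {y})))"

definition adm_sets :: "'a pair_pre_digraph \<Rightarrow> 'a set set" where
  "adm_sets \<Gamma> = {adm \<Gamma> Y |Y. Y \<subseteq> pverts \<Gamma>}"

definition dominates :: "'a pair_pre_digraph \<Rightarrow> 'a \<Rightarrow> 'a \<Rightarrow> bool" where
  "dominates \<Gamma> x y \<longleftrightarrow> perp \<Gamma> {x} \<inter> perp \<Gamma> {y} = perp \<Gamma> {y} - {y}"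

definition Dom :: "'a pair_pre_digraph \<Rightarrow> 'a set" where
  "Dom \<Gamma> = {y \<in> pverts \<Gamma>. \<exists>x\<in>pverts \<Gamma>. dominates \<Gamma> x y}"

lemma graph_dist_le_1_iff:
  assumes "pair_graph \<Gamma>" "u \<in> pverts \<Gamma>"
  shows "graph_dist \<Gamma> u v \<le> 1 \<longleftrightarrow> u = v \<or> (u, v) \<in> parcs \<Gamma>"
proof -
  interpret pair_graph \<Gamma> by fact
  have cost: "awalk_cost (\<lambda>_. 1) p = real (length p)" for p :: "('a \<times> 'a) list"
    by (induction p) auto
  show ?thesis
  proof
    assume "graph_dist \<Gamma> u v \<le> 1"
    then have "(INF p\<in>{p. awalk u p v}. ereal (awalk_cost (\<lambda>_. 1) p)) < 2"
      unfolding graph_dist_def \<mu>_def by (rule le_less_trans) simp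
    then obtain p where "awalk u p v" "ereal (real (length p)) < 2"
      by (auto simp: INF_less_iff cost)
    then have "awalk u p v" "length p = 0 \<or> length p = 1"
      by (auto simp: less_Suc_eq numeral_2_eq_2)
    then show "u = v \<or> (u, v) \<in> parcs \<Gamma>"
      by (auto simp: awalk_def length_Suc_conv)
  next
    assume "u = v \<or> (u, v) \<in> parcs \<Gamma>"
    then have "awalk u (if u = v then [] else [(u, v)]) v"
      using assms(2) by (auto simp: awalk_def)
    from min_cost_le_walk_cost[OF this, of "\<lambda>_. 1"]
    show "graph_dist \<Gamma> u v \<le> 1"
      unfolding graph_dist_def by (rule order_trans) (auto simp: cost)
  qed
qed


section \<open>Groups of automorphisms\<close>

text \<open>\<^term>\<open>auto G\<close> consists of the automorphisms of \<^term>\<open>G\<close>, extended by \<^term>\<open>undefined\<close> outside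
  \<^term>\<open>carrier G\<close>; the image of \<^term>\<open>g\<close> under \<open>\<phi>\<close> acting on the right is \<open>\<phi> g\<close>.\<close>

definition stab :: "'a pair_pre_digraph \<Rightarrow> 'a set set \<Rightarrow> ('a word set \<Rightarrow> 'a word set) set" where
  "stab \<Gamma> \<Y> = {\<phi> \<in> auto (pc_group \<Gamma>). \<forall>Y\<in>\<Y>. \<phi> ` pc_sub \<Gamma> Y = pc_sub \<Gamma> Y}"

definition stab_conj :: "'a pair_pre_digraph \<Rightarrow> 'a set set \<Rightarrow> ('a word set \<Rightarrow> 'a word set) set" where
  "stab_conj \<Gamma> \<Y> = {\<phi> \<in> auto (pc_group \<Gamma>). \<forall>Y\<in>\<Y>. \<exists>f\<in>carrier (pc_group \<Gamma>).
     \<phi> ` pc_sub \<Gamma> Y = conjugate_set (pc_group \<Gamma>) (pc_sub \<Gamma> Y) f}"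

definition Conj :: "'a pair_pre_digraph \<Rightarrow> ('a word set \<Rightarrow> 'a word set) set" where
  "Conj \<Gamma> = {\<phi> \<in> auto (pc_group \<Gamma>). \<forall>x\<in>pverts \<Gamma>. \<exists>g\<in>carrier (pc_group \<Gamma>).
     \<phi> (pc_gen \<Gamma> x) = conjugate (pc_group \<Gamma>) (pc_gen \<Gamma> x) g}"

definition Conj_N :: "'a pair_pre_digraph \<Rightarrow> ('a word set \<Rightarrow> 'a word set) set" where
  "Conj_N \<Gamma> = {\<phi> \<in> Conj \<Gamma>. \<forall>x\<in>pverts \<Gamma>. \<exists>f\<in>carrier (pc_group \<Gamma>). \<forall>y\<in>adm \<Gamma> {x}.
     \<phi> (pc_gen \<Gamma> y) = conjugate (pc_group \<Gamma>) (pc_gen \<Gamma> y) f}"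

text \<open>\<open>is_semidirect A S N H\<close>: inside the group \<open>A\<close>, the subgroup \<open>S\<close> is the internal semidirect
  product \<open>N \<rtimes> H\<close>.\<close>

definition is_semidirect :: "('g, 'm) monoid_scheme \<Rightarrow> 'g set \<Rightarrow> 'g set \<Rightarrow> 'g set \<Rightarrow> bool" where
  "is_semidirect A S N H \<longleftrightarrow>
     subgroup S A \<and> N \<lhd> A\<lparr>carrier := S\<rparr> \<and> subgroup H (A\<lparr>carrier := S\<rparr>) \<and>
     N \<inter> H = {\<one>\<^bsub>A\<^esub>} \<and> N <#>\<^bsub>A\<^esub> H = S"

end

theory Submission
  imports Defs "HOL-Algebra.Elementary_Groups"
begin

text \<open>
  For a vertex \<open>x\<close> the set \<open>cl(x)\<close> is a clique contained in \<open>\<aa>(x)\<close>, and a vertex of \<open>\<aa>(x)\<close>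
  outside \<open>cl(x)\<close> is the same thing as a vertex dominating \<open>x\<close>. So \<open>Dom(\<Gamma>) = \<emptyset>\<close> says that
  \<open>\<aa>(x) = cl(x)\<close> for every \<open>x\<close>.

  Suppose that this is the case. Every \<open>G(\<aa>(x))\<close> is then free abelian, and two facts about the group
  drive the argument. The retraction of \<open>G\<close> onto \<open>G(Y)\<close> that kills the other generators shows that
  elements of an abelian \<open>G(Y)\<close> which are conjugate in \<open>G\<close> are equal (\<open>conjugate_in_clique\<close>). Conversely,
  pairwise commuting conjugates of the vertices of a clique have a common conjugator
  (\<open>clique_conjugate\<close>); this rests on the centralizer of a generator (\<open>centralizer_gen\<close>). By the second
  fact, a conjugating automorphism acts on each \<open>G(\<aa>(x))\<close> as conjugation by one element, which gives
  \<open>Conj(G) = Conj\<^sub>N(G) \<subseteq> St\<^sup>c\<^sup>o\<^sup>n\<^sup>j(\<K>)\<close> and normality. By the first, \<open>Conj(G)\<close> meets \<open>St(\<K>)\<close> trivially.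
  Finally, if \<open>\<psi>\<close> maps each \<open>G(\<aa>(x))\<close> onto its conjugate by \<open>f\<^sub>x\<close>, then undoing these conjugations separately
  on each \<open>G(\<aa>(x))\<close> yields an automorphism in \<open>St(\<K>)\<close> which differs from \<open>\<psi>\<close> by an element of
  \<open>Conj(G)\<close> (\<open>stab_conj_factor\<close>). The groups \<open>St(\<L>)\<close> and \<open>St(\<K>)\<close> coincide, because a closed set is
  the union of the sets \<open>cl(y)\<close> of its elements \<open>y\<close>.

  Now let \<open>x\<close> dominate \<open>y\<close>. Every admissible set containing \<open>y\<close> contains \<open>x\<close>, so the transvection
  \<open>y \<mapsto> yx\<close> and the partial conjugation \<open>y \<mapsto> y\<^sup>x\<close> both lie in \<open>St(\<K>)\<close>. The latter is a nontrivial
  element of \<open>Conj(G) \<inter> St(\<K>)\<close>, so these two groups form no semidirect product. The former is not in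
  \<open>Conj(G) \<cdot> St(\<L>)\<close>, which rules out the two decompositions with \<open>St(\<L>)\<close>: conjugating
  automorphisms preserve the exponent sum of \<open>x\<close>, and automorphisms in \<open>St(\<L>)\<close> keep the image of \<open>y\<close>
  inside \<open>G(cl(y))\<close>, where this exponent sum vanishes.
\<close>

section \<open>Conjugation and generation in a group\<close>

context group
begin

lemma inv_mult_cancel [simp]:
  assumes "a \<in> carrier G" "b \<in> carrier G"
  shows "inv a \<otimes> (a \<otimes> b) = b" and "a \<otimes> (inv a \<otimes> b) = b"
  using assms by (simp_all add: m_assoc[symmetric])

lemma conjugate_closed [simp]:
  "g \<in> carrier G \<Longrightarrow> h \<in> carrier G \<Longrightarrow> conjugate G g h \<in> carrier G"
  by (simp add: conjugate_def)

lemma conjugate_one [simp]: "g \<in> carrier G \<Longrightarrow> conjugate G g \<one> = g"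
  by (simp add: conjugate_def)

lemma conjugate_conjugate:
  "g \<in> carrier G \<Longrightarrow> h \<in> carrier G \<Longrightarrow> k \<in> carrier G \<Longrightarrow>
    conjugate G (conjugate G g h) k = conjugate G g (h \<otimes> k)"
  by (simp add: conjugate_def m_assoc inv_mult_group)

lemma conjugate_hom: "h \<in> carrier G \<Longrightarrow> (\<lambda>g. conjugate G g h) \<in> hom G G"
  by (rule homI) (simp_all add: conjugate_def m_assoc)

lemma conjugate_eq_iff_commute:
  assumes "g \<in> carrier G" "h \<in> carrier G"
  shows "conjugate G g h = g \<longleftrightarrow> g \<otimes> h = h \<otimes> g"
proof
  assume "conjugate G g h = g"
  then have "h \<otimes> (inv h \<otimes> (g \<otimes> h)) = h \<otimes> g"
    using assms by (simp add: conjugate_def m_assoc)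
  then show "g \<otimes> h = h \<otimes> g" using assms by simp
next
  assume "g \<otimes> h = h \<otimes> g"
  then show "conjugate G g h = g" using assms by (simp add: conjugate_def m_assoc)
qed

lemma conjugate_inj:
  assumes "conjugate G a h = conjugate G b h" "a \<in> carrier G" "b \<in> carrier G" "h \<in> carrier G"
  shows "a = b"
proof -
  have "conjugate G (conjugate G a h) (inv h) = conjugate G (conjugate G b h) (inv h)"
    using assms(1) by simp
  then show ?thesis using assms(2-) by (simp add: conjugate_conjugate)
qed

lemma commutator_eq_one_iff:
  assumes "a \<in> carrier G" "b \<in> carrier G"
  shows "inv a \<otimes> (inv b \<otimes> (a \<otimes> b)) = \<one> \<longleftrightarrow> a \<otimes> b = b \<otimes> a"
proof
  assume "inv a \<otimes> (inv b \<otimes> (a \<otimes> b)) = \<one>"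
  then have "b \<otimes> (a \<otimes> (inv a \<otimes> (inv b \<otimes> (a \<otimes> b)))) = b \<otimes> a" using assms by simp
  then show "a \<otimes> b = b \<otimes> a" using assms by simp
qed (use assms in simp)

lemma subgroup_mult_iff:
  assumes "subgroup H G" "h \<in> H" "g \<in> carrier G"
  shows "g \<otimes> h \<in> H \<longleftrightarrow> g \<in> H" and "h \<otimes> g \<in> H \<longleftrightarrow> g \<in> H"
proof -
  interpret H: subgroup H G by fact
  have "g \<otimes> h \<otimes> inv h = g" "inv h \<otimes> (h \<otimes> g) = g" using assms by (simp_all add: m_assoc)
  then show "g \<otimes> h \<in> H \<longleftrightarrow> g \<in> H" "h \<otimes> g \<in> H \<longleftrightarrow> g \<in> H"
    using assms(2) H.m_closed H.m_inv_closed by metis+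
qed

lemma commute_generate:
  assumes "a \<in> carrier G" "S \<subseteq> carrier G" "\<And>s. s \<in> S \<Longrightarrow> a \<otimes> s = s \<otimes> a"
    and "g \<in> generate G S"
  shows "a \<otimes> g = g \<otimes> a"
  using assms(4)
proof induction
  case (inv h)
  then have h: "h \<in> carrier G" "a \<otimes> h = h \<otimes> a" using assms by auto
  have "inv h \<otimes> a = inv h \<otimes> (a \<otimes> h) \<otimes> inv h" using h(1) assms(1) by (simp add: m_assoc)
  also have "\<dots> = inv h \<otimes> (h \<otimes> a) \<otimes> inv h" by (simp only: h(2))
  also have "\<dots> = a \<otimes> inv h" using h(1) assms(1) by (simp add: m_assoc)
  finally show ?case by simp
next
  case (eng g h)
  then have "g \<in> carrier G" "h \<in> carrier G" using generate_in_carrier[OF assms(2)] by auto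
  with eng assms(1) show ?case by (metis m_assoc)
qed (use assms in auto)

lemma generate_commute:
  assumes "S \<subseteq> carrier G" "T \<subseteq> carrier G" "\<And>s t. s \<in> S \<Longrightarrow> t \<in> T \<Longrightarrow> s \<otimes> t = t \<otimes> s"
    and "g \<in> generate G S" "h \<in> generate G T"
  shows "g \<otimes> h = h \<otimes> g"
proof (rule commute_generate[OF _ assms(2) _ assms(5)])
  show "g \<in> carrier G" using assms generate_in_carrier by blast
  fix t assume t: "t \<in> T"
  then have "t \<otimes> g = g \<otimes> t"
    by (intro commute_generate[OF _ assms(1) _ assms(4)]) (use assms(2) assms(3)[OF _ t, symmetric] t in auto)
  then show "g \<otimes> t = t \<otimes> g" by simp
qed

end

lemma hom_conjugate:
  assumes "group G" "group H" "\<phi> \<in> hom G H" "g \<in> carrier G" "h \<in> carrier G"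
  shows "\<phi> (conjugate G g h) = conjugate H (\<phi> g) (\<phi> h)"
proof -
  interpret group_hom G H \<phi> using assms by (simp add: group_hom_def group_hom_axioms_def)
  show ?thesis using assms by (simp add: conjugate_def)
qed

lemma hom_eq_on_generate:
  assumes "group G" "group H" "\<phi> \<in> hom G H" "\<psi> \<in> hom G H" "S \<subseteq> carrier G"
    and "\<And>s. s \<in> S \<Longrightarrow> \<phi> s = \<psi> s" and "g \<in> generate G S"
  shows "\<phi> g = \<psi> g"
proof -
  interpret f: group_hom G H \<phi> using assms by (simp add: group_hom_def group_hom_axioms_def)
  interpret g: group_hom G H \<psi> using assms by (simp add: group_hom_def group_hom_axioms_def)
  note C = f.G.generate_in_carrier[OF assms(5)]
  show ?thesis
    using assms(7)
  proof induction
    case (inv h)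
    then show ?case using assms(5,6) by (auto simp: subset_iff)
  next
    case (eng a b)
    then show ?case using C[of a] C[of b] by simp
  qed (use assms(6) in auto)
qed

lemma hom_generate_into:
  assumes "group G" "group H" "\<phi> \<in> hom G H" "S \<subseteq> carrier G" "subgroup K H"
    and "\<And>s. s \<in> S \<Longrightarrow> \<phi> s \<in> K" and "g \<in> generate G S"
  shows "\<phi> g \<in> K"
proof -
  interpret f: group_hom G H \<phi> using assms by (simp add: group_hom_def group_hom_axioms_def)
  have "\<phi> ` generate G S \<subseteq> K"
    unfolding f.generate_img[OF assms(4), symmetric]
    using assms(6) by (intro f.H.generate_subgroup_incl[OF _ assms(5)]) auto
  then show ?thesis using assms(7) by auto
qed


section \<open>The universal property of a presentation\<close>

primrec word_eval :: "('g, 'm) monoid_scheme \<Rightarrow> ('a \<Rightarrow> 'g) \<Rightarrow> 'a word \<Rightarrow> 'g" where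
  "word_eval K f [] = \<one>\<^bsub>K\<^esub>"
| "word_eval K f (a # w) = (if snd a then f (fst a) else inv\<^bsub>K\<^esub> f (fst a)) \<otimes>\<^bsub>K\<^esub> word_eval K f w"

lemma Cons_in_words [simp]: "a # w \<in> words X \<longleftrightarrow> fst a \<in> X \<and> w \<in> words X"
  by (cases a) (auto simp: words_def)

lemma Nil_in_words [simp]: "[] \<in> words X"
  by (simp add: words_def)

lemma append_in_words [simp]: "u @ v \<in> words X \<longleftrightarrow> u \<in> words X \<and> v \<in> words X"
  by (auto simp: words_def)

context group
begin

lemma word_eval_closed [simp]:
  assumes "f \<in> X \<rightarrow> carrier G" "w \<in> words X"
  shows "word_eval G f w \<in> carrier G"
  using assms(2) by (induction w) (use assms(1) in \<open>auto simp: Pi_def\<close>)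

lemma word_eval_append:
  assumes "f \<in> X \<rightarrow> carrier G" "u \<in> words X" "v \<in> words X"
  shows "word_eval G f (u @ v) = word_eval G f u \<otimes> word_eval G f v"
  using assms(2)
proof (induction u)
  case Nil
  then show ?case using assms by simp
next
  case (Cons a u)
  moreover have "f (fst a) \<in> carrier G" using Cons assms(1) by auto
  moreover have "word_eval G f u \<in> carrier G" "word_eval G f v \<in> carrier G"
    using Cons assms by (auto intro: word_eval_closed)
  ultimately show ?case by (simp add: m_assoc)
qed

lemma word_eval_pres_cong:
  assumes f: "f \<in> X \<rightarrow> carrier G" and R: "R \<subseteq> words X"
    and rel: "\<And>r. r \<in> R \<Longrightarrow> word_eval G f r = \<one>" and "(u, v) \<in> pres_cong X R"
  shows "word_eval G f u = word_eval G f v"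
  using assms(4)
proof induction
  case (cancel u v x b)
  then have "f x \<in> carrier G" using f by auto
  moreover have "word_eval G f u \<in> carrier G" "word_eval G f v \<in> carrier G"
    using cancel f by (auto intro: word_eval_closed)
  ultimately show ?case
    using cancel by (simp add: word_eval_append[OF f])
next
  case (relator u v r)
  moreover have "word_eval G f v \<in> carrier G" using relator f by (auto intro: word_eval_closed)
  moreover have "r \<in> words X" using relator R by auto
  ultimately show ?case by (simp add: word_eval_append[OF f] rel)
qed auto

end

lemma pres_class_mult:
  assumes R: "R \<subseteq> words X" and "u \<in> words X" "v \<in> words X"
  shows "pres_cong X R `` {u} \<otimes>\<^bsub>pres_group X R\<^esub> pres_cong X R `` {v} = pres_cong X R `` {u @ v}"
proof -
  note eq = equiv_pres_cong[OF R]
  have "(\<lambda>u v. pres_cong X R `` {u @ v}) respects2 pres_cong X R"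
    by (intro congruent2I') (use pres_cong_append[OF R] eq in \<open>auto intro!: equiv_class_eq\<close>)
  from UN_equiv_class2[OF eq eq this assms(2,3)] show ?thesis by (simp add: pres_group_def)
qed

lemma pres_group_carrierE:
  assumes "A \<in> carrier (pres_group X R)"
  obtains u where "u \<in> words X" "A = pres_cong X R `` {u}"
  using assms by (auto simp: pres_group_def elim: quotientE)

lemma pres_gen_closed: "x \<in> X \<Longrightarrow> pres_gen X R x \<in> carrier (pres_group X R)"
  by (simp add: pres_gen_def pres_group_def quotientI)

theorem pres_group_universal:
  fixes K (structure)
  assumes K: "group K" and f: "f \<in> X \<rightarrow> carrier K" and R: "R \<subseteq> words X"
    and rel: "\<And>r. r \<in> R \<Longrightarrow> word_eval K f r = \<one>"
  obtains \<phi> where "\<phi> \<in> hom (pres_group X R) K" "\<And>x. x \<in> X \<Longrightarrow> \<phi> (pres_gen X R x) = f x"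
proof -
  interpret group K by fact
  let ?E = "pres_cong X R"
  define \<phi> where "\<phi> A = word_eval K f (SOME u. u \<in> A)" for A
  have \<phi>: "\<phi> (?E `` {u}) = word_eval K f u" if "u \<in> words X" for u
  proof -
    have "(u, SOME v. v \<in> ?E `` {u}) \<in> ?E"
      using someI[of "\<lambda>v. v \<in> ?E `` {u}" u] that by (auto intro: pres_cong.refl)
    from word_eval_pres_cong[OF f R rel this] show ?thesis by (simp add: \<phi>_def)
  qed
  show thesis
  proof
    show "\<phi> \<in> hom (pres_group X R) K"
    proof (rule homI)
      fix A assume "A \<in> carrier (pres_group X R)"
      then obtain u where u: "u \<in> words X" "A = ?E `` {u}" by (rule pres_group_carrierE)
      then show "\<phi> A \<in> carrier K" using \<phi> f by (auto intro: word_eval_closed)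
      fix B assume "B \<in> carrier (pres_group X R)"
      then obtain v where "v \<in> words X" "B = ?E `` {v}" by (rule pres_group_carrierE)
      with u show "\<phi> (A \<otimes>\<^bsub>pres_group X R\<^esub> B) = \<phi> A \<otimes> \<phi> B"
        by (simp add: pres_class_mult[OF R] \<phi> word_eval_append[OF f])
    qed
    fix x assume "x \<in> X"
    moreover from this f have "f x \<in> carrier K" by auto
    ultimately show "\<phi> (pres_gen X R x) = f x" by (simp add: pres_gen_def \<phi>)
  qed
qed

lemma inv_pres_gen:
  assumes R: "R \<subseteq> words X" and "x \<in> X"
  shows "inv\<^bsub>pres_group X R\<^esub> pres_gen X R x = pres_cong X R `` {[(x, False)]}"
proof -
  interpret group "pres_group X R" using R by (rule group_pres_group)
  note eq = equiv_pres_cong[OF R]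
  have "([(x, False), (x, True)], []) \<in> pres_cong X R"
    using pres_cong.cancel[of "[]" X "[]" x False R] assms by simp
  then have "pres_cong X R `` {[(x, False), (x, True)]} = pres_cong X R `` {[]}"
    using equiv_class_eq[OF eq] by simp
  then have "pres_cong X R `` {[(x, False)]} \<otimes>\<^bsub>pres_group X R\<^esub> pres_gen X R x = \<one>\<^bsub>pres_group X R\<^esub>"
    using assms by (simp add: pres_gen_def pres_class_mult) (simp add: pres_group_def)
  then show ?thesis
    using assms by (intro inv_equality pres_gen_closed)
      (simp_all add: pres_group_def quotientI)
qed

lemma pres_class_eq_word_eval:
  assumes R: "R \<subseteq> words X" and "w \<in> words X"
  shows "pres_cong X R `` {w} = word_eval (pres_group X R) (pres_gen X R) w"
  using assms(2)
proof (induction w)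
  case Nil
  then show ?case by (simp add: pres_group_def)
next
  case (Cons a w)
  then have "pres_cong X R `` {a # w}
      = pres_cong X R `` {[a]} \<otimes>\<^bsub>pres_group X R\<^esub> pres_cong X R `` {w}"
    using pres_class_mult[OF R, of "[a]" w] by simp
  moreover have "pres_cong X R `` {[a]} = (if snd a then pres_gen X R (fst a)
      else inv\<^bsub>pres_group X R\<^esub> pres_gen X R (fst a))"
    using Cons R by (cases a) (auto simp: inv_pres_gen[unfolded pres_gen_def] pres_gen_def)
  ultimately show ?case using Cons by simp
qed

lemma carrier_pres_group:
  assumes R: "R \<subseteq> words X"
  shows "carrier (pres_group X R) = generate (pres_group X R) (pres_gen X R ` X)"
proof
  interpret group "pres_group X R" using R by (rule group_pres_group)
  show "generate (pres_group X R) (pres_gen X R ` X) \<subseteq> carrier (pres_group X R)"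
    by (intro generate_incl) (auto intro: pres_gen_closed)
  have "word_eval (pres_group X R) (pres_gen X R) w \<in> generate (pres_group X R) (pres_gen X R ` X)"
    if "w \<in> words X" for w
    using that by (induction w) (auto intro: generate.intros)
  then show "carrier (pres_group X R) \<subseteq> generate (pres_group X R) (pres_gen X R ` X)"
    by (auto elim!: pres_group_carrierE simp: pres_class_eq_word_eval[OF R])
qed

section \<open>Partially commutative groups\<close>

locale pc_graph =
  fixes \<Gamma> :: "'a pair_pre_digraph"
  assumes graph: "pair_graph \<Gamma>"
begin

abbreviation "X \<equiv> pverts \<Gamma>"
abbreviation "G \<equiv> pc_group \<Gamma>"
abbreviation "\<gamma> \<equiv> pc_gen \<Gamma>"
abbreviation "S \<equiv> pc_sub \<Gamma>"

abbreviation gmult (infixl \<open>\<cdot>\<close> 70) where "g \<cdot> h \<equiv> g \<otimes>\<^bsub>pc_group \<Gamma>\<^esub> h"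
abbreviation cnj (infixl \<open>\<triangleleft>\<close> 75) where "g \<triangleleft> h \<equiv> conjugate (pc_group \<Gamma>) g h"

definition adj :: "'a \<Rightarrow> 'a \<Rightarrow> bool" (infix \<open>\<sim>\<close> 50) where
  "x \<sim> y \<longleftrightarrow> x = y \<or> (x, y) \<in> parcs \<Gamma>"

sublocale group G
  using graph by (rule group_pc_group)

lemma relators: "pc_relators \<Gamma> \<subseteq> words X"
proof -
  interpret pair_graph \<Gamma> by (rule graph)
  show ?thesis by (auto simp: pc_relators_def dest: in_arcsD1 in_arcsD2)
qed

lemma adj_refl [simp]: "x \<sim> x"
  by (simp add: adj_def)

lemma adj_sym: "x \<sim> y \<longleftrightarrow> y \<sim> x"
proof -
  interpret pair_graph \<Gamma> by (rule graph)
  show ?thesis using arcs_symmetric by (auto simp: adj_def)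
qed

lemma perp_iff: "perp \<Gamma> Y = {u \<in> X. \<forall>y\<in>Y. u \<sim> y}"
  using graph_dist_le_1_iff[OF graph] by (auto simp: perp_def adj_def)

lemma finite_verts: "finite X"
proof -
  interpret pair_graph \<Gamma> by (rule graph)
  show ?thesis by simp
qed

lemma gen_closed [simp]: "x \<in> X \<Longrightarrow> \<gamma> x \<in> carrier G"
  unfolding pc_gen_def pc_group_def by (rule pres_gen_closed)

lemma gen_image_closed: "Y \<subseteq> X \<Longrightarrow> \<gamma> ` Y \<subseteq> carrier G"
  by auto

lemma sub_subgroup: "Y \<subseteq> X \<Longrightarrow> subgroup (S Y) G"
  unfolding pc_sub_def by (rule generate_is_subgroup) auto

lemma sub_in_carrier: "Y \<subseteq> X \<Longrightarrow> g \<in> S Y \<Longrightarrow> g \<in> carrier G"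
  using sub_subgroup[THEN subgroup.subset] by auto

lemma gen_in_sub: "y \<in> Y \<Longrightarrow> \<gamma> y \<in> S Y"
  unfolding pc_sub_def by (auto intro: generate.incl)

lemma sub_mono: "Y \<subseteq> Z \<Longrightarrow> S Y \<subseteq> S Z"
  unfolding pc_sub_def by (intro mono_generate) auto

lemma carrier_eq_sub: "carrier G = S X"
  using carrier_pres_group[OF relators]
  by (simp add: pc_sub_def pc_group_def pc_gen_def[abs_def])

lemma gen_commute:
  assumes "x \<in> X" "y \<in> X" "x \<sim> y"
  shows "\<gamma> x \<cdot> \<gamma> y = \<gamma> y \<cdot> \<gamma> x"
proof (cases "x = y")
  case False
  let ?r = "[(x, False), (y, False), (x, True), (y, True)]"
  have r: "?r \<in> pc_relators \<Gamma>" using False assms by (auto simp: pc_relators_def adj_def)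
  have "(?r, []) \<in> pres_cong X (pc_relators \<Gamma>)"
    using pres_cong.relator[of "[]" X "[]", OF _ _ r] by simp
  then have "pres_cong X (pc_relators \<Gamma>) `` {?r} = \<one>\<^bsub>G\<^esub>"
    using equiv_class_eq[OF equiv_pres_cong[OF relators]] by (simp add: pc_group_def pres_group_def)
  then have "word_eval G \<gamma> ?r = \<one>\<^bsub>G\<^esub>"
    using assms by (subst (asm) pres_class_eq_word_eval[OF relators])
      (simp_all add: pc_group_def pc_gen_def[abs_def])
  then show ?thesis
    using assms commutator_eq_one_iff[of "\<gamma> x" "\<gamma> y"] by simp
qed simp

text \<open>The universal property of \<open>G\<close>: the relators are commutators of adjacent vertices, and these evaluate to 1
  exactly if the images commute.\<close>

lemma hom_exists:
  assumes K: "group K" and f: "\<And>x. x \<in> X \<Longrightarrow> f x \<in> carrier K"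
    and comm: "\<And>x y. x \<in> X \<Longrightarrow> y \<in> X \<Longrightarrow> x \<noteq> y \<Longrightarrow> x \<sim> y \<Longrightarrow> f x \<otimes>\<^bsub>K\<^esub> f y = f y \<otimes>\<^bsub>K\<^esub> f x"
  obtains \<phi> where "\<phi> \<in> hom G K" "\<And>x. x \<in> X \<Longrightarrow> \<phi> (\<gamma> x) = f x"
proof -
  interpret pair_graph \<Gamma> by (rule graph)
  interpret K: group K by fact
  have f': "f \<in> X \<rightarrow> carrier K" using f by auto
  have "word_eval K f r = \<one>\<^bsub>K\<^esub>" if r: "r \<in> pc_relators \<Gamma>" for r
  proof -
    obtain x y where xy: "r = [(x, False), (y, False), (x, True), (y, True)]" "(x, y) \<in> parcs \<Gamma>"
      using r by (auto simp: pc_relators_def)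
    then have "x \<in> X" "y \<in> X" "x \<noteq> y" "x \<sim> y"
      by (auto simp: adj_def dest: in_arcsD1 in_arcsD2 no_loops)
    then show ?thesis
      using K.commutator_eq_one_iff[of "f x" "f y"] comm[of x y] f by (simp add: xy)
  qed
  from pres_group_universal[OF K f' relators this] that show thesis
    unfolding pc_group_def pc_gen_def by blast
qed

lemma hom_eq:
  assumes "group K" "\<phi> \<in> hom G K" "\<psi> \<in> hom G K" "Y \<subseteq> X" "\<And>y. y \<in> Y \<Longrightarrow> \<phi> (\<gamma> y) = \<psi> (\<gamma> y)"
    and "g \<in> S Y"
  shows "\<phi> g = \<psi> g"
  using hom_eq_on_generate[OF group_axioms assms(1-3) gen_image_closed[OF assms(4)]] assms(5,6)
  by (auto simp: pc_sub_def)

lemma hom_into: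
  assumes "group K" "\<phi> \<in> hom G K" "Y \<subseteq> X" "subgroup H K" "\<And>y. y \<in> Y \<Longrightarrow> \<phi> (\<gamma> y) \<in> H"
    and "g \<in> S Y"
  shows "\<phi> g \<in> H"
  using hom_generate_into[OF group_axioms assms(1,2) gen_image_closed[OF assms(3)] assms(4)] assms(5,6)
  by (auto simp: pc_sub_def)

lemma sub_commute:
  assumes "Y \<subseteq> X" "Z \<subseteq> X" "\<And>y z. y \<in> Y \<Longrightarrow> z \<in> Z \<Longrightarrow> y \<sim> z" "g \<in> S Y" "h \<in> S Z"
  shows "g \<cdot> h = h \<cdot> g"
proof (rule generate_commute[OF gen_image_closed[OF assms(1)] gen_image_closed[OF assms(2)]])
  fix s t assume "s \<in> \<gamma> ` Y" "t \<in> \<gamma> ` Z"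
  then show "s \<cdot> t = t \<cdot> s" using assms(1-3) gen_commute by blast
qed (use assms(4,5) in \<open>simp_all add: pc_sub_def\<close>)

section \<open>Exponent sums and retractions\<close>

text \<open>The exponent sum of the generator \<open>x\<close>, a homomorphism to the integers, separates \<open>x\<close> from the
  subgroups generated by other vertices and is invariant under conjugation.\<close>

lemma exponent_sum:
  obtains \<epsilon> where "\<epsilon> \<in> hom G integer_group" "\<And>y. y \<in> X \<Longrightarrow> \<epsilon> (\<gamma> y) = (if y = x then 1 else 0)"
  by (rule hom_exists[of integer_group "\<lambda>y. if y = x then 1 else 0"]) auto

lemma exponent_sum_sub:
  assumes "\<epsilon> \<in> hom G integer_group" "\<And>y. y \<in> X \<Longrightarrow> \<epsilon> (\<gamma> y) = (if y = x then 1 else 0)"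
    and "Y \<subseteq> X" "x \<notin> Y" "g \<in> S Y"
  shows "\<epsilon> g = 0"
proof -
  have "\<epsilon> g \<in> {\<one>\<^bsub>integer_group\<^esub>}"
    by (rule hom_into[OF _ assms(1,3) group.triv_subgroup]) (use assms in auto)
  then show ?thesis by simp
qed

lemma gen_in_sub_iff:
  assumes "x \<in> X" "Y \<subseteq> X"
  shows "\<gamma> x \<in> S Y \<longleftrightarrow> x \<in> Y"
proof
  assume "\<gamma> x \<in> S Y"
  obtain \<epsilon> where \<epsilon>: "\<epsilon> \<in> hom G integer_group" "\<And>y. y \<in> X \<Longrightarrow> \<epsilon> (\<gamma> y) = (if y = x then 1 else 0)"
    using exponent_sum by blast
  show "x \<in> Y"
  proof (rule ccontr)
    assume "x \<notin> Y"
    from exponent_sum_sub[OF \<epsilon> assms(2) this \<open>\<gamma> x \<in> S Y\<close>] \<epsilon>(2)[of x] assms(1)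
    show False by simp
  qed
qed (rule gen_in_sub)

text \<open>Killing the vertices outside \<open>Y\<close> respects the defining relations. This makes \<open>G(Y)\<close> a retract of
  \<open>G\<close>, which replaces normal forms in most of what follows.\<close>

lemma retraction:
  assumes Y: "Y \<subseteq> X"
  obtains \<rho> where "\<rho> \<in> hom G G" "\<And>g. g \<in> carrier G \<Longrightarrow> \<rho> g \<in> S Y" "\<And>g. g \<in> S Y \<Longrightarrow> \<rho> g = g"
    "\<And>x. x \<in> X - Y \<Longrightarrow> \<rho> (\<gamma> x) = \<one>\<^bsub>G\<^esub>"
proof -
  obtain \<rho> where \<rho>: "\<rho> \<in> hom G G" "\<And>x. x \<in> X \<Longrightarrow> \<rho> (\<gamma> x) = (if x \<in> Y then \<gamma> x else \<one>\<^bsub>G\<^esub>)"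
    by (rule hom_exists[OF group_axioms, of "\<lambda>x. if x \<in> Y then \<gamma> x else \<one>\<^bsub>G\<^esub>"])
      (use gen_commute in auto)
  show thesis
  proof
    fix g assume "g \<in> carrier G"
    then have "g \<in> S X" by (simp add: carrier_eq_sub)
    show "\<rho> g \<in> S Y"
      by (rule hom_into[OF group_axioms \<rho>(1) order_refl sub_subgroup[OF Y] _ \<open>g \<in> S X\<close>])
        (use \<rho>(2) subgroup.one_closed[OF sub_subgroup[OF Y]] in \<open>auto intro: gen_in_sub\<close>)
  next
    fix g assume "g \<in> S Y"
    have "(\<lambda>g. g) \<in> hom G G" by (auto simp: hom_def)
    from hom_eq[OF group_axioms \<rho>(1) this Y _ \<open>g \<in> S Y\<close>] show "\<rho> g = g"
      using \<rho>(2) Y by (simp add: subset_iff)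
  qed (use \<rho> in auto)
qed

text \<open>Apply the retraction onto \<open>G(Y)\<close> to \<open>g\<^sup>h\<close>: it fixes both \<open>g\<close> and \<open>g\<^sup>h\<close>, so its value on \<open>h\<close> is the
  required conjugator.\<close>

lemma conjugate_in_sub:
  assumes Y: "Y \<subseteq> X" and "g \<in> S Y" "h \<in> carrier G" "g \<triangleleft> h \<in> S Y"
  obtains k where "k \<in> S Y" "g \<triangleleft> h = g \<triangleleft> k"
proof -
  obtain \<rho> where \<rho>: "\<rho> \<in> hom G G" "\<And>g. g \<in> carrier G \<Longrightarrow> \<rho> g \<in> S Y" "\<And>g. g \<in> S Y \<Longrightarrow> \<rho> g = g"
    using retraction[OF Y] by metis
  have "g \<triangleleft> h = \<rho> (g \<triangleleft> h)" using \<rho>(3) assms(4) by simp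
  also have "\<dots> = \<rho> g \<triangleleft> \<rho> h"
    using assms sub_in_carrier[OF Y] by (intro hom_conjugate[OF group_axioms group_axioms \<rho>(1)])
  finally show thesis using that[of "\<rho> h"] \<rho> assms by simp
qed

text \<open>The retraction onto \<open>G(A)\<close> maps the generators of \<open>G(B)\<close> into \<open>G(A \<inter> B)\<close>, and it fixes every element
  of \<open>G(A)\<close>.\<close>

lemma sub_Int:
  assumes "A \<subseteq> X" "B \<subseteq> X"
  shows "S A \<inter> S B = S (A \<inter> B)"
proof
  obtain \<rho> where \<rho>: "\<rho> \<in> hom G G" "\<And>g. g \<in> S A \<Longrightarrow> \<rho> g = g" "\<And>x. x \<in> X - A \<Longrightarrow> \<rho> (\<gamma> x) = \<one>\<^bsub>G\<^esub>"
    using retraction[OF assms(1)] by metis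
  have "\<rho> g \<in> S (A \<inter> B)" if "g \<in> S B" for g
  proof (rule hom_into[OF group_axioms \<rho>(1) assms(2) sub_subgroup _ that])
    fix y assume "y \<in> B"
    show "\<rho> (\<gamma> y) \<in> S (A \<inter> B)"
    proof (cases "y \<in> A")
      case True
      then show ?thesis using \<rho>(2)[OF gen_in_sub[OF True]] \<open>y \<in> B\<close> by (auto intro: gen_in_sub)
    next
      case False
      then show ?thesis
        using \<rho>(3)[of y] \<open>y \<in> B\<close> assms subgroup.one_closed[OF sub_subgroup[of "A \<inter> B"]]
        by (simp add: subset_iff)
    qed
  qed (use assms in auto)
  then show "S A \<inter> S B \<subseteq> S (A \<inter> B)" using \<rho>(2) by fastforce
qed (use sub_mono in auto)

lemma sub_perp_if:
  assumes "finite C" "g \<in> carrier G" "\<And>z. z \<in> C \<Longrightarrow> g \<in> S (perp \<Gamma> {z})"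
  shows "g \<in> S (perp \<Gamma> C)"
  using assms(1,3)
proof (induction C)
  case empty
  then show ?case using assms(2) by (simp add: perp_iff carrier_eq_sub)
next
  case (insert z C)
  then have "g \<in> S (perp \<Gamma> {z}) \<inter> S (perp \<Gamma> C)" by auto
  also have "\<dots> = S (perp \<Gamma> {z} \<inter> perp \<Gamma> C)"
    by (rule sub_Int) (auto simp: perp_iff)
  also have "perp \<Gamma> {z} \<inter> perp \<Gamma> C = perp \<Gamma> (insert z C)" by (auto simp: perp_iff)
  finally show ?case .
qed

text \<open>A conjugator can be chosen inside \<open>G(C)\<close>, which is abelian.\<close>

lemma conjugate_in_clique:
  assumes C: "C \<subseteq> X" "\<And>x y. x \<in> C \<Longrightarrow> y \<in> C \<Longrightarrow> x \<sim> y"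
    and "g \<in> S C" "h \<in> carrier G" "g \<triangleleft> h \<in> S C"
  shows "g \<triangleleft> h = g"
proof -
  obtain k where k: "k \<in> S C" "g \<triangleleft> h = g \<triangleleft> k" using conjugate_in_sub[OF C(1) assms(3-5)] by blast
  then have "g \<cdot> k = k \<cdot> g" using sub_commute[OF C(1) C(1) C(2)] assms by blast
  then show ?thesis
    using k assms sub_in_carrier[OF C(1)] by (simp add: conjugate_eq_iff_commute)
qed

section \<open>The centralizer of a generator\<close>

text \<open>The proof that the centralizer of \<open>x\<close> lies in \<open>P = G(x\<^sup>\<perp>)\<close> uses an invariant in place of normal
  forms. Read the word \<open>w\<close> letter by letter as a path in \<open>G\<close> that starts at \<open>c\<close>; \<open>flips P x c w\<close> is the
  parity of the number of letters \<open>x\<^sup>\<plusminus>\<^sup>1\<close> that are read while the path is inside \<open>P\<close>. Such a letter does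
  not leave \<open>P\<close>, so it is irrelevant whether membership is tested before or after reading it.\<close>

primrec flips :: "'a word set set \<Rightarrow> 'a \<Rightarrow> 'a word set \<Rightarrow> 'a word \<Rightarrow> bool" where
  "flips P x c [] = False"
| "flips P x c (a # w) = ((fst a = x \<and> c \<in> P) \<noteq> flips P x (c \<cdot> word_eval G \<gamma> [a]) w)"

lemma eval_closed [simp]: "w \<in> words X \<Longrightarrow> word_eval G \<gamma> w \<in> carrier G"
  by (rule word_eval_closed) auto

lemma eval_append: "u \<in> words X \<Longrightarrow> v \<in> words X \<Longrightarrow>
    word_eval G \<gamma> (u @ v) = word_eval G \<gamma> u \<cdot> word_eval G \<gamma> v"
  by (rule word_eval_append) auto

lemma flips_append:
  assumes "c \<in> carrier G" "u \<in> words X" "v \<in> words X"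
  shows "flips P x c (u @ v) = (flips P x c u \<noteq> flips P x (c \<cdot> word_eval G \<gamma> u) v)"
  using assms
proof (induction u arbitrary: c)
  case (Cons a u)
  have a: "[a] \<in> words X" and u: "u \<in> words X" using Cons.prems by auto
  have "c \<cdot> word_eval G \<gamma> (a # u) = c \<cdot> word_eval G \<gamma> [a] \<cdot> word_eval G \<gamma> u"
    using eval_append[OF a u] Cons.prems(1) eval_closed[OF a] eval_closed[OF u]
    by (simp only: append_Cons append_Nil m_assoc)
  then show ?case
    using Cons.IH[of "c \<cdot> word_eval G \<gamma> [a]"] Cons.prems eval_closed[OF a]
    by (simp del: word_eval.simps) blast
qed simp

text \<open>The parity depends only on the group element. In an inserted \<open>x\<^sup>\<plusminus>\<^sup>1x\<^sup>\<mp>\<^sup>1\<close>, and in an inserted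
  commutator of \<open>x\<close> with a neighbour, all letters belong to \<open>P\<close>; so either both of its letters
  \<open>x\<^sup>\<plusminus>\<^sup>1\<close> are read inside \<open>P\<close> or neither is.\<close>

lemma flips_pres_cong:
  assumes P: "P = S (perp \<Gamma> {x})" and x: "x \<in> X" and "c \<in> carrier G"
    and "(u, v) \<in> pres_cong X (pc_relators \<Gamma>)"
  shows "flips P x c u = flips P x c v"
proof -
  have sub: "subgroup P G" unfolding P by (rule sub_subgroup) (auto simp: perp_iff)
  have right: "d \<cdot> p \<in> P \<longleftrightarrow> d \<in> P" "d \<cdot> inv\<^bsub>G\<^esub> p \<in> P \<longleftrightarrow> d \<in> P"
    if "p \<in> P" "d \<in> carrier G" for d p
    using subgroup_mult_iff(1)[OF sub] subgroup.m_inv_closed[OF sub] that by blast+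
  have gen: "\<gamma> y \<in> P" if "y \<in> X" "y \<sim> x" for y
    using that unfolding P by (auto simp: perp_iff intro: gen_in_sub)
  have insert: "flips P x c (u @ r @ v) = flips P x c (u @ v)"
    if r: "word_eval G \<gamma> r = \<one>\<^bsub>G\<^esub>" "r \<in> words X" "\<And>d. d \<in> carrier G \<Longrightarrow> \<not> flips P x d r"
      and uv: "u \<in> words X" "v \<in> words X" for u v r
    using assms(3) uv r eval_closed[OF uv(1)] by (simp add: flips_append)
  show ?thesis
    using assms(4)
  proof induction
    case (cancel u v y b)
    have "word_eval G \<gamma> [(y, b), (y, \<not> b)] = \<one>\<^bsub>G\<^esub>" "[(y, b), (y, \<not> b)] \<in> words X"
      using cancel by auto
    moreover have "\<not> flips P x d [(y, b), (y, \<not> b)]" if "d \<in> carrier G" for d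
      using that gen[of x] x cancel by (cases b) (auto simp: right)
    ultimately show ?case using insert[of "[(y, b), (y, \<not> b)]" u v] cancel by simp
  next
    case (relator u v r)
    then obtain y z where r: "r = [(y, False), (z, False), (y, True), (z, True)]"
      and yz: "(y, z) \<in> parcs \<Gamma>" by (auto simp: pc_relators_def)
    have rX: "r \<in> words X" using relator relators by auto
    then have X: "y \<in> X" "z \<in> X" by (auto simp: r)
    have yz': "y \<sim> z" "z \<sim> y" using yz adj_sym by (auto simp: adj_def)
    have 1: "word_eval G \<gamma> r = \<one>\<^bsub>G\<^esub>"
      using X yz' gen_commute commutator_eq_one_iff[of "\<gamma> y" "\<gamma> z"] by (simp add: r)
    have "\<not> flips P x d r" if d: "d \<in> carrier G" for d
    proof -
      have yP: "\<gamma> y \<in> P" if "y = x \<or> z = x" using gen X yz' that by auto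
      have zP: "\<gamma> z \<in> P" if "y = x \<or> z = x" using gen X yz' that by auto
      show ?thesis
        using X d yP zP by (cases "y = x"; cases "z = x") (auto simp: r right)
    qed
    then show ?case using insert[OF 1 rX] relator by blast
  qed auto
qed

text \<open>Count parities along \<open>gx\<close> and along \<open>xg\<close>, starting at 1. The first path contributes the count for
  \<open>g\<close>, and a flip for the last letter iff \<open>g \<in> P\<close>. The second contributes a flip for the first letter
  and then the count for \<open>g\<close> from \<open>x\<close>, which equals the count from 1 because the count is unchanged when the
  starting point is multiplied on the left by an element of \<open>P\<close>. If \<open>gx = xg\<close>, comparison gives \<open>g \<in> P\<close>.\<close>

theorem centralizer_gen:
  assumes x: "x \<in> X" and g: "g \<in> carrier G" and comm: "g \<cdot> \<gamma> x = \<gamma> x \<cdot> g"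
  shows "g \<in> S (perp \<Gamma> {x})"
proof -
  define P where "P = S (perp \<Gamma> {x})"
  have sub: "subgroup P G" unfolding P_def by (rule sub_subgroup) (auto simp: perp_iff)
  have xP: "\<gamma> x \<in> P" unfolding P_def using x by (auto simp: perp_iff intro: gen_in_sub)
  obtain w where w: "w \<in> words X" "g = pres_cong X (pc_relators \<Gamma>) `` {w}"
    using g by (auto simp: pc_group_def elim: pres_group_carrierE)
  have eval: "word_eval G \<gamma> u = pres_cong X (pc_relators \<Gamma>) `` {u}" if "u \<in> words X" for u
    using pres_class_eq_word_eval[OF relators that] by (simp add: pc_group_def pc_gen_def[abs_def])
  have gw: "g = word_eval G \<gamma> w" using w eval by simp
  let ?x = "[(x, True)]"
  have evx: "word_eval G \<gamma> ?x = \<gamma> x" using x by simp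
  have left: "flips P x (p \<cdot> c) u = flips P x c u"
    if "u \<in> words X" "c \<in> carrier G" "p \<in> P" for p c u
    using that
  proof (induction u arbitrary: c)
    case (Cons a u)
    have a: "[a] \<in> words X" using Cons.prems by simp
    have p: "p \<in> carrier G" using Cons.prems sub by (auto simp: subgroup_def)
    have "p \<cdot> c \<in> P \<longleftrightarrow> c \<in> P" using subgroup_mult_iff(2)[OF sub] Cons.prems by blast
    then show ?case
      using Cons.IH[of "c \<cdot> word_eval G \<gamma> [a]"] Cons.prems eval_closed[OF a] p
      by (simp add: m_assoc del: word_eval.simps)
  qed simp
  have "(w @ ?x, ?x @ w) \<in> pres_cong X (pc_relators \<Gamma>)"
  proof -
    have "word_eval G \<gamma> (w @ ?x) = word_eval G \<gamma> (?x @ w)"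
      using comm x w evx by (simp add: eval_append gw del: word_eval.simps append_Cons)
    then show ?thesis
      using eq_equiv_class[OF _ equiv_pres_cong[OF relators], of "w @ ?x" "?x @ w"] x w
      by (simp add: eval del: word_eval.simps append_Cons)
  qed
  from flips_pres_cong[OF P_def x one_closed this]
  have "(flips P x \<one>\<^bsub>G\<^esub> w \<noteq> flips P x g ?x) = (flips P x \<one>\<^bsub>G\<^esub> ?x \<noteq> flips P x (\<gamma> x) w)"
    using w x evx g by (simp add: flips_append gw[symmetric] del: word_eval.simps append_Cons flips.simps)
  moreover have "flips P x (\<gamma> x) w = flips P x \<one>\<^bsub>G\<^esub> w"
    using left[OF w(1) one_closed xP] x by simp
  ultimately have "flips P x g ?x = flips P x \<one>\<^bsub>G\<^esub> ?x" by blast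
  then show ?thesis using sub by (simp add: subgroup_def P_def)
qed

text \<open>Induct over the clique. After conjugating, the vertices of \<open>C\<close> are fixed and the new \<open>y\<^sup>h\<close> commutes
  with all of them. By the centralizer theorem it lies in \<open>G(C\<^sup>\<perp>)\<close>, which also contains \<open>y\<close>; hence
  \<open>h\<close> can be replaced by an element of \<open>G(C\<^sup>\<perp>)\<close>, and conjugation by such an element keeps the vertices of \<open>C\<close> fixed.\<close>

theorem clique_conjugate:
  assumes "finite C" "C \<subseteq> X" "\<And>y z. y \<in> C \<Longrightarrow> z \<in> C \<Longrightarrow> y \<sim> z"
    and "\<And>y. y \<in> C \<Longrightarrow> f y \<in> carrier G"
    and "\<And>y z. y \<in> C \<Longrightarrow> z \<in> C \<Longrightarrow> \<gamma> y \<triangleleft> f y \<cdot> (\<gamma> z \<triangleleft> f z) = \<gamma> z \<triangleleft> f z \<cdot> (\<gamma> y \<triangleleft> f y)"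
  shows "\<exists>e\<in>carrier G. \<forall>y\<in>C. \<gamma> y \<triangleleft> f y = \<gamma> y \<triangleleft> e"
  using assms
proof (induction C)
  case (insert y C)
  then obtain e where e: "e \<in> carrier G" "\<And>z. z \<in> C \<Longrightarrow> \<gamma> z \<triangleleft> f z = \<gamma> z \<triangleleft> e"
    by (metis insertCI insert_subset)
  let ?Z = "perp \<Gamma> C"
  have y: "y \<in> X" "f y \<in> carrier G" and C: "C \<subseteq> X" using insert by auto
  define h where "h = f y \<cdot> inv\<^bsub>G\<^esub> e"
  have h: "h \<in> carrier G" using y e by (simp add: h_def)
  have fy: "\<gamma> y \<triangleleft> f y = \<gamma> y \<triangleleft> h \<triangleleft> e" using y e by (simp add: h_def conjugate_conjugate m_assoc)
  have Z: "?Z \<subseteq> X" by (auto simp: perp_iff)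
  have "\<gamma> y \<triangleleft> h \<in> S ?Z"
  proof (rule sub_perp_if)
    fix z assume z: "z \<in> C"
    then have zX: "z \<in> X" using C by auto
    have "\<gamma> y \<triangleleft> h \<triangleleft> e \<cdot> (\<gamma> z \<triangleleft> e) = \<gamma> z \<triangleleft> e \<cdot> (\<gamma> y \<triangleleft> h \<triangleleft> e)"
      using insert.prems(4)[of y z] z fy e by simp
    then have "(\<gamma> y \<triangleleft> h \<cdot> \<gamma> z) \<triangleleft> e = (\<gamma> z \<cdot> (\<gamma> y \<triangleleft> h)) \<triangleleft> e"
      using hom_mult[OF conjugate_hom[OF e(1)]] y h zX by simp
    then have "\<gamma> y \<triangleleft> h \<cdot> \<gamma> z = \<gamma> z \<cdot> (\<gamma> y \<triangleleft> h)"
      by (rule conjugate_inj) (use y h zX e in auto)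
    then show "\<gamma> y \<triangleleft> h \<in> S (perp \<Gamma> {z})" using zX y h by (intro centralizer_gen) auto
  qed (use insert y h in auto)
  moreover have "y \<in> ?Z" using y insert.prems(2) by (auto simp: perp_iff)
  ultimately obtain k where k: "k \<in> S ?Z" "\<gamma> y \<triangleleft> h = \<gamma> y \<triangleleft> k"
    using conjugate_in_sub[OF Z gen_in_sub h] by metis
  have kG: "k \<in> carrier G" using k sub_in_carrier[OF Z] by blast
  have "\<gamma> z \<triangleleft> f z = \<gamma> z \<triangleleft> (k \<cdot> e)" if z: "z \<in> insert y C" for z
  proof (cases "z = y")
    case True
    then show ?thesis using fy k y kG e by (simp add: conjugate_conjugate)
  next
    case False
    then have "z \<in> C" "z \<in> X" using z C by auto
    have "k \<cdot> \<gamma> z = \<gamma> z \<cdot> k"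
      using sub_commute[OF Z C _ k(1) gen_in_sub[OF \<open>z \<in> C\<close>]] by (auto simp: perp_iff)
    then have "\<gamma> z \<triangleleft> k = \<gamma> z" using \<open>z \<in> X\<close> kG by (simp add: conjugate_eq_iff_commute)
    then show ?thesis
      using e \<open>z \<in> C\<close> \<open>z \<in> X\<close> kG by (simp add: conjugate_conjugate[symmetric])
  qed
  then show ?case using kG e by blast
qed auto

section \<open>Groups of automorphisms\<close>

abbreviation "A \<equiv> AutoGroup G"
abbreviation cset (infixl \<open>\<triangleleft>\<triangleleft>\<close> 75) where "H \<triangleleft>\<triangleleft> h \<equiv> conjugate_set G H h"

lemma A_group: "group A"
  by (rule AutoGroup)

lemma A_carrier [simp]: "carrier A = auto G"
  by (simp add: AutoGroup_def)

lemma auto_hom: "\<phi> \<in> auto G \<Longrightarrow> \<phi> \<in> hom G G"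
  and auto_bij: "\<phi> \<in> auto G \<Longrightarrow> bij_betw \<phi> (carrier G) (carrier G)"
  and auto_extensional: "\<phi> \<in> auto G \<Longrightarrow> \<phi> \<in> extensional (carrier G)"
  by (auto simp: auto_def Bij_def)

lemma auto_closed [simp]: "\<phi> \<in> auto G \<Longrightarrow> g \<in> carrier G \<Longrightarrow> \<phi> g \<in> carrier G"
  by (rule hom_in_carrier[OF auto_hom])

lemma auto_mult: "\<phi> \<in> auto G \<Longrightarrow> g \<in> carrier G \<Longrightarrow> h \<in> carrier G \<Longrightarrow> \<phi> (g \<cdot> h) = \<phi> g \<cdot> \<phi> h"
  by (rule hom_mult[OF auto_hom])

lemma auto_conjugate: "\<phi> \<in> auto G \<Longrightarrow> g \<in> carrier G \<Longrightarrow> h \<in> carrier G \<Longrightarrow> \<phi> (g \<triangleleft> h) = \<phi> g \<triangleleft> \<phi> h"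
  using hom_conjugate[OF group_axioms group_axioms auto_hom] .

lemma A_mult_apply [simp]:
  "\<phi> \<in> auto G \<Longrightarrow> \<psi> \<in> auto G \<Longrightarrow> g \<in> carrier G \<Longrightarrow> (\<phi> \<otimes>\<^bsub>A\<^esub> \<psi>) g = \<phi> (\<psi> g)"
  by (simp add: AutoGroup_def BijGroup_def auto_def compose_def)

lemma A_one_apply [simp]: "g \<in> carrier G \<Longrightarrow> \<one>\<^bsub>A\<^esub> g = g"
  by (simp add: AutoGroup_def BijGroup_def)

lemma A_mult_closed [simp]: "\<phi> \<in> auto G \<Longrightarrow> \<psi> \<in> auto G \<Longrightarrow> \<phi> \<otimes>\<^bsub>A\<^esub> \<psi> \<in> auto G"
  using monoid.m_closed[OF group.is_monoid[OF A_group]] by simp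

lemma A_one_closed [simp]: "\<one>\<^bsub>A\<^esub> \<in> auto G"
  using monoid.one_closed[OF group.is_monoid[OF A_group]] by simp

lemma A_inv_closed [simp]: "\<phi> \<in> auto G \<Longrightarrow> inv\<^bsub>A\<^esub> \<phi> \<in> auto G"
  using group.inv_closed[OF A_group] by simp

lemma A_inv_apply [simp]:
  assumes "\<phi> \<in> auto G" "g \<in> carrier G"
  shows "\<phi> ((inv\<^bsub>A\<^esub> \<phi>) g) = g" and "(inv\<^bsub>A\<^esub> \<phi>) (\<phi> g) = g"
proof -
  have "(\<phi> \<otimes>\<^bsub>A\<^esub> inv\<^bsub>A\<^esub> \<phi>) g = g" "(inv\<^bsub>A\<^esub> \<phi> \<otimes>\<^bsub>A\<^esub> \<phi>) g = g"
    using group.r_inv[OF A_group, of \<phi>] group.l_inv[OF A_group, of \<phi>] assms by simp_all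
  then show "\<phi> ((inv\<^bsub>A\<^esub> \<phi>) g) = g" "(inv\<^bsub>A\<^esub> \<phi>) (\<phi> g) = g" using assms by simp_all
qed

lemma auto_eqI:
  assumes "\<phi> \<in> auto G" "\<psi> \<in> auto G" "\<And>x. x \<in> X \<Longrightarrow> \<phi> (\<gamma> x) = \<psi> (\<gamma> x)"
  shows "\<phi> = \<psi>"
proof (rule extensionalityI[OF auto_extensional auto_extensional])
  fix g assume "g \<in> carrier G"
  then show "\<phi> g = \<psi> g"
    using hom_eq[OF group_axioms auto_hom auto_hom order_refl] assms carrier_eq_sub by blast
qed (use assms in auto)

text \<open>Automorphisms are built from a pair of endomorphisms inverse to each other on the generators; having
  the inverse at hand also shows that \<open>G(Y)\<close> is mapped onto, and not only into, itself.\<close>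

lemma auto_from_inverse_homs:
  assumes h: "h \<in> hom G G" and k: "k \<in> hom G G"
    and hk: "\<And>x. x \<in> X \<Longrightarrow> h (k (\<gamma> x)) = \<gamma> x" and kh: "\<And>x. x \<in> X \<Longrightarrow> k (h (\<gamma> x)) = \<gamma> x"
  shows "restrict h (carrier G) \<in> auto G"
    and "Y \<subseteq> X \<Longrightarrow> (\<And>y. y \<in> Y \<Longrightarrow> h (\<gamma> y) \<in> S Y \<and> k (\<gamma> y) \<in> S Y) \<Longrightarrow> restrict h (carrier G) ` S Y = S Y"
proof -
  have inv: "f (e g) = g" if "f \<in> hom G G" "e \<in> hom G G" "\<And>x. x \<in> X \<Longrightarrow> f (e (\<gamma> x)) = \<gamma> x"
    "g \<in> carrier G" for f e g
  proof -
    have "(\<lambda>g. g) \<in> hom G G" by (simp add: hom_def)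
    from hom_eq[OF group_axioms Group.hom_compose[OF that(2,1)] this order_refl] that(3,4) carrier_eq_sub
    show ?thesis by simp
  qed
  have closed: "f g \<in> carrier G" if "f \<in> hom G G" "g \<in> carrier G" for f g
    using that by (rule hom_in_carrier)
  have "bij_betw (restrict h (carrier G)) (carrier G) (carrier G)"
    by (rule bij_betw_byWitness[where f' = k]) (use inv[OF h k hk] inv[OF k h kh] closed h k in auto)
  moreover have "restrict h (carrier G) \<in> hom G G"
    using h by (auto simp: hom_def)
  ultimately show "restrict h (carrier G) \<in> auto G" by (simp add: auto_def Bij_def)
  assume Y: "Y \<subseteq> X" and *: "\<And>y. y \<in> Y \<Longrightarrow> h (\<gamma> y) \<in> S Y \<and> k (\<gamma> y) \<in> S Y"
  have into: "f g \<in> S Y" if "f \<in> hom G G" "\<And>y. y \<in> Y \<Longrightarrow> f (\<gamma> y) \<in> S Y" "g \<in> S Y" for f g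
    using hom_into[OF group_axioms that(1) Y sub_subgroup[OF Y] that(2,3)] .
  show "restrict h (carrier G) ` S Y = S Y"
  proof
    show "restrict h (carrier G) ` S Y \<subseteq> S Y"
      using into[OF h] * sub_in_carrier[OF Y] by auto
    show "S Y \<subseteq> restrict h (carrier G) ` S Y"
    proof
      fix g assume g: "g \<in> S Y"
      then have "k g \<in> S Y" "g \<in> carrier G" using into[OF k] * sub_in_carrier[OF Y] by auto
      then show "g \<in> restrict h (carrier G) ` S Y"
        using inv[OF h k hk] sub_in_carrier[OF Y] by (intro image_eqI[of _ _ "k g"]) auto
    qed
  qed
qed

lemma cset_cset: "H \<subseteq> carrier G \<Longrightarrow> f \<in> carrier G \<Longrightarrow> e \<in> carrier G \<Longrightarrow> H \<triangleleft>\<triangleleft> f \<triangleleft>\<triangleleft> e = H \<triangleleft>\<triangleleft> (f \<cdot> e)"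
  unfolding conjugate_set_def image_image
  by (intro image_cong) (simp_all add: conjugate_conjugate subset_iff)

lemma cset_one [simp]: "H \<subseteq> carrier G \<Longrightarrow> H \<triangleleft>\<triangleleft> \<one>\<^bsub>G\<^esub> = H"
  using image_cong[of H H "\<lambda>g. g \<triangleleft> \<one>\<^bsub>G\<^esub>" "\<lambda>g. g"] by (simp add: conjugate_set_def subset_iff)

lemma auto_cset:
  "\<phi> \<in> auto G \<Longrightarrow> H \<subseteq> carrier G \<Longrightarrow> f \<in> carrier G \<Longrightarrow> \<phi> ` (H \<triangleleft>\<triangleleft> f) = (\<phi> ` H) \<triangleleft>\<triangleleft> \<phi> f"
  unfolding conjugate_set_def image_image
  by (intro image_cong) (simp_all add: auto_conjugate subset_iff)

lemma A_mult_image: "\<phi> \<in> auto G \<Longrightarrow> \<psi> \<in> auto G \<Longrightarrow> H \<subseteq> carrier G \<Longrightarrow> (\<phi> \<otimes>\<^bsub>A\<^esub> \<psi>) ` H = \<phi> ` \<psi> ` H"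
  unfolding image_image by (intro image_cong) (simp_all add: subset_iff)

lemma A_inv_image: "\<phi> \<in> auto G \<Longrightarrow> H \<subseteq> carrier G \<Longrightarrow> (inv\<^bsub>A\<^esub> \<phi>) ` \<phi> ` H = H"
  using image_cong[of H H "\<lambda>g. (inv\<^bsub>A\<^esub> \<phi>) (\<phi> g)" "\<lambda>g. g"] by (simp add: image_image subset_iff)

lemma A_one_image: "H \<subseteq> carrier G \<Longrightarrow> \<one>\<^bsub>A\<^esub> ` H = H"
  using image_cong[of H H "\<one>\<^bsub>A\<^esub>" "\<lambda>g. g"] by (simp add: subset_iff)

lemma sub_subset_carrier: "Y \<subseteq> X \<Longrightarrow> S Y \<subseteq> carrier G"
  using sub_in_carrier by auto

lemma subgroup_stab:
  assumes "\<Y> \<subseteq> Pow X"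
  shows "subgroup (stab \<Gamma> \<Y>) A"
proof (rule group.subgroupI[OF A_group])
  have Y: "S Y \<subseteq> carrier G" if "Y \<in> \<Y>" for Y using assms that sub_subset_carrier by blast
  show "stab \<Gamma> \<Y> \<subseteq> carrier A" by (auto simp: stab_def)
  have "\<one>\<^bsub>A\<^esub> \<in> stab \<Gamma> \<Y>" using Y by (simp add: stab_def A_one_image)
  then show "stab \<Gamma> \<Y> \<noteq> {}" by auto
  fix \<phi> assume \<phi>: "\<phi> \<in> stab \<Gamma> \<Y>"
  then have aut: "\<phi> \<in> auto G" by (simp add: stab_def)
  have "(inv\<^bsub>A\<^esub> \<phi>) ` S Y = S Y" if "Y \<in> \<Y>" for Y
    using A_inv_image[OF aut Y[OF that]] \<phi> that by (simp add: stab_def)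
  then show "inv\<^bsub>A\<^esub> \<phi> \<in> stab \<Gamma> \<Y>" using aut by (simp add: stab_def)
  fix \<psi> assume "\<psi> \<in> stab \<Gamma> \<Y>"
  then show "\<phi> \<otimes>\<^bsub>A\<^esub> \<psi> \<in> stab \<Gamma> \<Y>"
    using \<phi> Y by (simp add: stab_def A_mult_image)
qed

text \<open>If \<open>\<phi>\<close> maps \<open>G(Y)\<close> to \<open>G(Y)\<^sup>f\<close>, then applying \<open>\<phi>\<^sup>-\<^sup>1\<close> shows that \<open>G(Y)\<close> is the conjugate of
  \<open>\<phi>\<^sup>-\<^sup>1(G(Y))\<close> by \<open>\<phi>\<^sup>-\<^sup>1(f)\<close>.\<close>

lemma subgroup_stab_conj:
  assumes "\<Y> \<subseteq> Pow X"
  shows "subgroup (stab_conj \<Gamma> \<Y>) A"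
proof (rule group.subgroupI[OF A_group])
  have Y: "S Y \<subseteq> carrier G" if "Y \<in> \<Y>" for Y using assms that sub_subset_carrier by blast
  show "stab_conj \<Gamma> \<Y> \<subseteq> carrier A" by (auto simp: stab_conj_def)
  have "\<one>\<^bsub>A\<^esub> ` S Y = S Y \<triangleleft>\<triangleleft> \<one>\<^bsub>G\<^esub>" if "Y \<in> \<Y>" for Y
    using Y[OF that] by (simp add: A_one_image)
  then have "\<one>\<^bsub>A\<^esub> \<in> stab_conj \<Gamma> \<Y>" unfolding stab_conj_def by auto
  then show "stab_conj \<Gamma> \<Y> \<noteq> {}" by auto
  fix \<phi> assume \<phi>: "\<phi> \<in> stab_conj \<Gamma> \<Y>"
  then have aut: "\<phi> \<in> auto G" by (simp add: stab_conj_def)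
  let ?i = "inv\<^bsub>A\<^esub> \<phi>"
  have "\<exists>f\<in>carrier G. ?i ` S Y = S Y \<triangleleft>\<triangleleft> f" if "Y \<in> \<Y>" for Y
  proof -
    obtain f where f: "f \<in> carrier G" "\<phi> ` S Y = S Y \<triangleleft>\<triangleleft> f"
      using \<phi> \<open>Y \<in> \<Y>\<close> by (auto simp: stab_conj_def)
    have sub: "?i ` S Y \<subseteq> carrier G" using Y[OF that] aut by auto
    have "S Y = ?i ` S Y \<triangleleft>\<triangleleft> ?i f"
      using A_inv_image[OF aut Y[OF that]] auto_cset[of ?i "S Y" f] aut Y[OF that] f by simp
    then have "S Y \<triangleleft>\<triangleleft> inv\<^bsub>G\<^esub> (?i f) = ?i ` S Y \<triangleleft>\<triangleleft> ?i f \<triangleleft>\<triangleleft> inv\<^bsub>G\<^esub> (?i f)" by simp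
    also have "\<dots> = ?i ` S Y" using sub aut f by (simp add: cset_cset)
    finally show ?thesis using aut f by (intro bexI[of _ "inv\<^bsub>G\<^esub> (?i f)"]) auto
  qed
  then show "?i \<in> stab_conj \<Gamma> \<Y>" using aut by (simp add: stab_conj_def)
  fix \<psi> assume \<psi>: "\<psi> \<in> stab_conj \<Gamma> \<Y>"
  then have aut': "\<psi> \<in> auto G" by (simp add: stab_conj_def)
  have "\<exists>f\<in>carrier G. (\<phi> \<otimes>\<^bsub>A\<^esub> \<psi>) ` S Y = S Y \<triangleleft>\<triangleleft> f" if "Y \<in> \<Y>" for Y
  proof -
    obtain e where "e \<in> carrier G" "\<phi> ` S Y = S Y \<triangleleft>\<triangleleft> e"
      using \<phi> \<open>Y \<in> \<Y>\<close> by (auto simp: stab_conj_def)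
    moreover obtain f where "f \<in> carrier G" "\<psi> ` S Y = S Y \<triangleleft>\<triangleleft> f"
      using \<psi> \<open>Y \<in> \<Y>\<close> by (auto simp: stab_conj_def)
    ultimately show ?thesis
      using aut aut' Y[OF that]
      by (intro bexI[of _ "e \<cdot> \<phi> f"]) (simp_all add: A_mult_image auto_cset cset_cset)
  qed
  then show "\<phi> \<otimes>\<^bsub>A\<^esub> \<psi> \<in> stab_conj \<Gamma> \<Y>" using aut aut' by (simp add: stab_conj_def)
qed

lemma stab_subset_stab_conj:
  assumes "\<Y> \<subseteq> Pow X"
  shows "stab \<Gamma> \<Y> \<subseteq> stab_conj \<Gamma> \<Y>"
proof
  fix \<phi> assume "\<phi> \<in> stab \<Gamma> \<Y>"
  moreover have "S Y \<subseteq> carrier G" if "Y \<in> \<Y>" for Y using assms that sub_subset_carrier by blast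
  ultimately show "\<phi> \<in> stab_conj \<Gamma> \<Y>"
    unfolding stab_conj_def stab_def by (simp add: bexI[of _ "\<one>\<^bsub>G\<^esub>"])
qed

lemma Conj_auto: "\<phi> \<in> Conj \<Gamma> \<Longrightarrow> \<phi> \<in> auto G"
  by (simp add: Conj_def)

lemma subgroup_Conj: "subgroup (Conj \<Gamma>) A"
proof (rule group.subgroupI[OF A_group])
  show "Conj \<Gamma> \<subseteq> carrier A" by (auto simp: Conj_def)
  have "\<one>\<^bsub>A\<^esub> \<in> Conj \<Gamma>" unfolding Conj_def by (simp add: bexI[of _ "\<one>\<^bsub>G\<^esub>"])
  then show "Conj \<Gamma> \<noteq> {}" by auto
  fix \<phi> assume \<phi>: "\<phi> \<in> Conj \<Gamma>"
  note aut = Conj_auto[OF \<phi>]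
  let ?i = "inv\<^bsub>A\<^esub> \<phi>"
  have "\<exists>g\<in>carrier G. ?i (\<gamma> x) = \<gamma> x \<triangleleft> g" if x: "x \<in> X" for x
  proof -
    obtain g where g: "g \<in> carrier G" "\<phi> (\<gamma> x) = \<gamma> x \<triangleleft> g" using \<phi> x by (auto simp: Conj_def)
    have "\<gamma> x = ?i (\<phi> (\<gamma> x))" using aut x by simp
    also have "\<dots> = ?i (\<gamma> x) \<triangleleft> ?i g" unfolding g(2) using aut x g by (simp add: auto_conjugate)
    finally have "\<gamma> x \<triangleleft> inv\<^bsub>G\<^esub> (?i g) = ?i (\<gamma> x) \<triangleleft> ?i g \<triangleleft> inv\<^bsub>G\<^esub> (?i g)" by simp
    also have "\<dots> = ?i (\<gamma> x)" using aut x g by (simp add: conjugate_conjugate)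
    finally show ?thesis using aut g by (intro bexI[of _ "inv\<^bsub>G\<^esub> (?i g)"]) auto
  qed
  then show "?i \<in> Conj \<Gamma>" using aut by (simp add: Conj_def)
  fix \<psi> assume \<psi>: "\<psi> \<in> Conj \<Gamma>"
  note aut' = Conj_auto[OF \<psi>]
  have "\<exists>g\<in>carrier G. (\<phi> \<otimes>\<^bsub>A\<^esub> \<psi>) (\<gamma> x) = \<gamma> x \<triangleleft> g" if x: "x \<in> X" for x
  proof -
    obtain e f where "e \<in> carrier G" "\<phi> (\<gamma> x) = \<gamma> x \<triangleleft> e" "f \<in> carrier G" "\<psi> (\<gamma> x) = \<gamma> x \<triangleleft> f"
      using \<phi> \<psi> x unfolding Conj_def by blast
    then show ?thesis
      using aut aut' x
      by (intro bexI[of _ "e \<cdot> \<phi> f"]) (simp_all add: auto_conjugate conjugate_conjugate)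
  qed
  then show "\<phi> \<otimes>\<^bsub>A\<^esub> \<psi> \<in> Conj \<Gamma>" using aut aut' by (simp add: Conj_def)
qed

text \<open>The images of the vertices of a clique commute pairwise because \<open>\<phi>\<close> is a homomorphism.\<close>

lemma Conj_on_clique:
  assumes \<phi>: "\<phi> \<in> Conj \<Gamma>" and C: "C \<subseteq> X" "\<And>y z. y \<in> C \<Longrightarrow> z \<in> C \<Longrightarrow> y \<sim> z"
  obtains e where "e \<in> carrier G" "\<And>g. g \<in> S C \<Longrightarrow> \<phi> g = g \<triangleleft> e"
proof -
  note aut = Conj_auto[OF \<phi>]
  obtain f where f: "\<And>x. x \<in> X \<Longrightarrow> f x \<in> carrier G" "\<And>x. x \<in> X \<Longrightarrow> \<phi> (\<gamma> x) = \<gamma> x \<triangleleft> f x"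
    using \<phi> unfolding Conj_def by (simp, metis)
  have "\<gamma> y \<triangleleft> f y \<cdot> (\<gamma> z \<triangleleft> f z) = \<gamma> z \<triangleleft> f z \<cdot> (\<gamma> y \<triangleleft> f y)" if "y \<in> C" "z \<in> C" for y z
  proof -
    have X: "y \<in> X" "z \<in> X" using that C by auto
    have "\<phi> (\<gamma> y \<cdot> \<gamma> z) = \<phi> (\<gamma> z \<cdot> \<gamma> y)" using gen_commute[OF X C(2)[OF that]] by simp
    then show ?thesis using auto_mult[OF aut] X f by simp
  qed
  then have "\<exists>e\<in>carrier G. \<forall>y\<in>C. \<gamma> y \<triangleleft> f y = \<gamma> y \<triangleleft> e"
    by (intro clique_conjugate[OF finite_subset[OF C(1) finite_verts] C(1)])
      (simp_all add: C(2) f(1) subsetD[OF C(1)])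
  then obtain e where e: "e \<in> carrier G" "\<And>y. y \<in> C \<Longrightarrow> \<gamma> y \<triangleleft> f y = \<gamma> y \<triangleleft> e"
    by blast
  show thesis
  proof (rule that[OF e(1)])
    fix g assume "g \<in> S C"
    then show "\<phi> g = g \<triangleleft> e"
      using hom_eq[OF group_axioms auto_hom[OF aut] conjugate_hom[OF e(1)] C(1)] e f C(1)
      by (simp add: subset_iff)
  qed
qed

section \<open>Closed sets, admissible sets and domination\<close>

text \<open>With \<open>\<sim>\<close> meaning distance at most 1, all the notions below become statements about neighbourhoods:
  \<open>\<aa>(x)\<close> collects the vertices whose star contains the link of \<open>x\<close>, and \<open>cl(x)\<close> those whose star
  contains the star of \<open>x\<close>.\<close>

lemma adm_singleton:
  "x \<in> X \<Longrightarrow> adm \<Gamma> {x} = {z \<in> X. \<forall>u\<in>X. u \<sim> x \<and> u \<noteq> x \<longrightarrow> z \<sim> u}"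
  by (auto simp: adm_def perp_iff)

lemma cl_singleton: "x \<in> X \<Longrightarrow> cl \<Gamma> {x} = {z \<in> X. \<forall>u\<in>X. u \<sim> x \<longrightarrow> z \<sim> u}"
  by (auto simp: cl_def perp_iff)

text \<open>Evaluating the defining equation of domination at \<open>y\<close> itself gives that \<open>x\<close> and \<open>y\<close> are distinct and not
  adjacent; elsewhere it says that the link of \<open>y\<close> lies in the star of \<open>x\<close>.\<close>

lemma dominates_iff:
  assumes "x \<in> X" "y \<in> X"
  shows "dominates \<Gamma> x y \<longleftrightarrow> \<not> y \<sim> x \<and> (\<forall>u\<in>X. u \<sim> y \<and> u \<noteq> y \<longrightarrow> u \<sim> x)"
proof -
  have "perp \<Gamma> {x} \<inter> perp \<Gamma> {y} = {u \<in> X. u \<sim> x \<and> u \<sim> y}"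
    "perp \<Gamma> {y} - {y} = {u \<in> X. u \<sim> y \<and> u \<noteq> y}"
    unfolding perp_iff by fast+
  then have "dominates \<Gamma> x y \<longleftrightarrow> (\<forall>u\<in>X. (u \<sim> x \<and> u \<sim> y) = (u \<sim> y \<and> u \<noteq> y))"
    unfolding dominates_def by blast
  then show ?thesis using assms adj_refl by metis
qed

lemma adm_subset: "adm \<Gamma> Y \<subseteq> X"
  by (auto simp: adm_def perp_iff)

lemma adm_sets_Pow: "adm_sets \<Gamma> \<subseteq> Pow X"
  using adm_subset by (auto simp: adm_sets_def)

lemma subset_cl: "Y \<subseteq> X \<Longrightarrow> Y \<subseteq> cl \<Gamma> Y"
proof
  fix y assume "Y \<subseteq> X" "y \<in> Y"
  moreover have "y \<sim> u" if "u \<in> perp \<Gamma> Y" for u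
  proof -
    have "u \<sim> y" using that \<open>y \<in> Y\<close> by (simp add: perp_iff)
    then show ?thesis using adj_sym[of u y] by simp
  qed
  ultimately show "y \<in> cl \<Gamma> Y" unfolding cl_def by (auto simp: perp_iff[of "perp \<Gamma> Y"])
qed

lemma perp_closed:
  assumes "Z \<subseteq> X"
  shows "perp \<Gamma> Z \<in> closed_sets \<Gamma>"
proof -
  have P: "perp \<Gamma> Z \<subseteq> X" by (auto simp: perp_iff)
  have "cl \<Gamma> (perp \<Gamma> Z) \<subseteq> perp \<Gamma> Z"
    using subset_cl[OF assms] unfolding cl_def perp_iff[of "perp \<Gamma> (perp \<Gamma> Z)"] by (auto simp: perp_iff[of Z])
  then show ?thesis using subset_cl[OF P] P by (auto simp: closed_sets_def)
qed

lemma adm_sets_closed: "adm_sets \<Gamma> \<subseteq> closed_sets \<Gamma>"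
proof
  fix A assume "A \<in> adm_sets \<Gamma>"
  then obtain Y where Y: "Y \<subseteq> X" "A = adm \<Gamma> Y" by (auto simp: adm_sets_def)
  have "adm \<Gamma> Y = perp \<Gamma> (\<Union>y\<in>Y. perp \<Gamma> {y} - {y})"
    by (auto simp: adm_def perp_iff)
  moreover have "(\<Union>y\<in>Y. perp \<Gamma> {y} - {y}) \<subseteq> X" by (auto simp: perp_iff)
  ultimately show "A \<in> closed_sets \<Gamma>" using perp_closed Y by simp
qed

text \<open>Let \<open>y \<in> \<aa>(z)\<close>. The vertex \<open>y\<close> is not in the link of \<open>z\<close>: otherwise \<open>z\<close>, being in the link of
  \<open>y\<close>, would be adjacent to \<open>x\<close>, and then \<open>x\<close>, being in the link of \<open>z\<close>, would be adjacent to \<open>y\<close>. So the link of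
  \<open>z\<close> lies in the link of \<open>y\<close>, hence in the star of \<open>x\<close>.\<close>

lemma adm_dominated:
  assumes "x \<in> X" "dominates \<Gamma> x y" "Y \<subseteq> X" "y \<in> adm \<Gamma> Y"
  shows "x \<in> adm \<Gamma> Y"
proof -
  have y: "y \<in> X" using assms adm_subset by blast
  have dom: "\<not> y \<sim> x" "\<And>u. u \<in> X \<Longrightarrow> u \<sim> y \<Longrightarrow> u \<noteq> y \<Longrightarrow> u \<sim> x"
    using assms(1,2) y by (auto simp: dominates_iff)
  have "x \<sim> u" if "z \<in> Y" "u \<in> X" "u \<sim> z" "u \<noteq> z" for z u
  proof -
    have *: "\<And>u. u \<in> X \<Longrightarrow> u \<sim> z \<Longrightarrow> u \<noteq> z \<Longrightarrow> y \<sim> u"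
      using assms(3,4) \<open>z \<in> Y\<close> by (auto simp: adm_def perp_iff split: if_splits)
    have "u \<noteq> y"
    proof
      assume "u = y"
      then have "z \<sim> x" using dom(2)[of z] that assms(3) adj_sym by blast
      moreover have "x \<noteq> z" using dom(1) that \<open>u = y\<close> by auto
      ultimately show False using *[of x] assms(1) dom(1) adj_sym by blast
    qed
    then show "x \<sim> u" using *[of u] dom(2)[of u] that adj_sym by blast
  qed
  then show ?thesis using assms(1) by (auto simp: adm_def perp_iff)
qed

section \<open>Graphs with a dominated vertex\<close>

text \<open>All neighbours of a dominated vertex \<open>y\<close> are neighbours of the dominating vertex \<open>x\<close>, so \<open>y\<close> may be
  replaced by any element that commutes with their common neighbours.\<close>

lemma hom_replacing_dominated:
  assumes "x \<in> X" "y \<in> X" "dominates \<Gamma> x y"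
  assumes s: "s \<in> carrier G" "\<And>u. u \<in> X \<Longrightarrow> u \<sim> y \<Longrightarrow> u \<sim> x \<Longrightarrow> \<gamma> u \<cdot> s = s \<cdot> \<gamma> u"
  shows "\<exists>\<phi>\<in>hom G G. \<phi> (\<gamma> y) = s \<and> (\<forall>u\<in>X. u \<noteq> y \<longrightarrow> \<phi> (\<gamma> u) = \<gamma> u)"
proof -
  have dom: "u \<sim> x" if "u \<in> X" "u \<sim> y" "u \<noteq> y" for u
    using assms(1-3) that by (simp add: dominates_iff)
  obtain \<phi> where \<phi>: "\<phi> \<in> hom G G" "\<And>u. u \<in> X \<Longrightarrow> \<phi> (\<gamma> u) = (if u = y then s else \<gamma> u)"
  proof (rule hom_exists[OF group_axioms, of "\<lambda>u. if u = y then s else \<gamma> u"])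
    fix u v assume uv: "u \<in> X" "v \<in> X" "u \<noteq> v" "u \<sim> v"
    have "\<gamma> v \<cdot> s = s \<cdot> \<gamma> v" if "u = y"
    proof -
      have "v \<sim> y" using uv that adj_sym by blast
      then show ?thesis using s(2) dom uv that by simp
    qed
    moreover have "\<gamma> u \<cdot> s = s \<cdot> \<gamma> u" if "v = y"
      using s(2) dom uv that by simp
    ultimately show "(if u = y then s else \<gamma> u) \<cdot> (if v = y then s else \<gamma> v)
        = (if v = y then s else \<gamma> v) \<cdot> (if u = y then s else \<gamma> u)"
      using gen_commute[OF uv(1,2,4)] uv(3) by simp
  qed (use s in auto)
  then show ?thesis using assms(2) by (intro bexI[of _ \<phi>]) simp_all
qed

text \<open>The common construction behind the transvection and the partial conjugation: \<open>y\<close> is replaced by a word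
  \<open>s\<close> in \<open>x\<close> and \<open>y\<close>, and the inverse automorphism replaces it by \<open>t\<close>. It stabilizes \<open>\<K>\<close> because
  an admissible set containing \<open>y\<close> also contains \<open>x\<close>.\<close>

lemma dominated_elementary_automorphism:
  assumes x: "x \<in> X" and y: "y \<in> X" and dom: "dominates \<Gamma> x y"
    and s: "s \<in> carrier G" "\<And>u. u \<in> X \<Longrightarrow> u \<sim> y \<Longrightarrow> u \<sim> x \<Longrightarrow> \<gamma> u \<cdot> s = s \<cdot> \<gamma> u"
    and t: "t \<in> carrier G" "\<And>u. u \<in> X \<Longrightarrow> u \<sim> y \<Longrightarrow> u \<sim> x \<Longrightarrow> \<gamma> u \<cdot> t = t \<cdot> \<gamma> u"
    and st: "s \<in> S {x, y}" "t \<in> S {x, y}"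
    and inv: "\<And>\<phi>. \<phi> \<in> hom G G \<Longrightarrow> \<phi> (\<gamma> x) = \<gamma> x \<Longrightarrow> \<phi> (\<gamma> y) = t \<Longrightarrow> \<phi> s = \<gamma> y"
      "\<And>\<phi>. \<phi> \<in> hom G G \<Longrightarrow> \<phi> (\<gamma> x) = \<gamma> x \<Longrightarrow> \<phi> (\<gamma> y) = s \<Longrightarrow> \<phi> t = \<gamma> y"
  obtains \<tau> where "\<tau> \<in> stab \<Gamma> (adm_sets \<Gamma>)" "\<tau> (\<gamma> y) = s" "\<And>u. u \<in> X \<Longrightarrow> u \<noteq> y \<Longrightarrow> \<tau> (\<gamma> u) = \<gamma> u"
proof -
  obtain h where h: "h \<in> hom G G" "h (\<gamma> y) = s" "\<And>u. u \<in> X \<Longrightarrow> u \<noteq> y \<Longrightarrow> h (\<gamma> u) = \<gamma> u"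
    using hom_replacing_dominated[OF x y dom s(1)] s(2) by auto
  obtain k where k: "k \<in> hom G G" "k (\<gamma> y) = t" "\<And>u. u \<in> X \<Longrightarrow> u \<noteq> y \<Longrightarrow> k (\<gamma> u) = \<gamma> u"
    using hom_replacing_dominated[OF x y dom t(1)] t(2) by auto
  have "x \<noteq> y" using dom x y by (auto simp: dominates_iff)
  have hk: "h (k (\<gamma> u)) = \<gamma> u" "k (h (\<gamma> u)) = \<gamma> u" if "u \<in> X" for u
  proof -
    show "h (k (\<gamma> u)) = \<gamma> u"
      using that inv(2)[OF h(1)] h k x \<open>x \<noteq> y\<close> by (cases "u = y") simp_all
    show "k (h (\<gamma> u)) = \<gamma> u"
      using that inv(1)[OF k(1)] h k x \<open>x \<noteq> y\<close> by (cases "u = y") simp_all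
  qed
  note aut = auto_from_inverse_homs[OF h(1) k(1) hk]
  have "restrict h (carrier G) ` S Y = S Y" if Y: "Y \<in> adm_sets \<Gamma>" for Y
  proof (rule aut(2))
    show YX: "Y \<subseteq> X" using Y adm_sets_Pow by auto
    fix u assume u: "u \<in> Y"
    show "h (\<gamma> u) \<in> S Y \<and> k (\<gamma> u) \<in> S Y"
    proof (cases "u = y")
      case True
      then have "{x, y} \<subseteq> Y" using adm_dominated[OF x dom] Y u by (auto simp: adm_sets_def)
      then show ?thesis using sub_mono st h k True by blast
    next
      case False
      then show ?thesis using h(3) k(3) u YX gen_in_sub[OF u] by (simp add: subset_iff)
    qed
  qed
  then have "restrict h (carrier G) \<in> stab \<Gamma> (adm_sets \<Gamma>)"
    using aut(1) by (simp add: stab_def)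
  then show thesis using that[of "restrict h (carrier G)"] h y by simp
qed

lemma dominated_transvection:
  assumes x: "x \<in> X" and y: "y \<in> X" and dom: "dominates \<Gamma> x y"
  obtains \<tau> where "\<tau> \<in> stab \<Gamma> (adm_sets \<Gamma>)" "\<tau> (\<gamma> y) = \<gamma> y \<cdot> \<gamma> x"
proof -
  have sub: "subgroup (S {x, y}) G" using x y by (intro sub_subgroup) auto
  have gens: "\<gamma> x \<in> S {x, y}" "\<gamma> y \<in> S {x, y}" by (simp_all add: gen_in_sub)
  have comm: "\<gamma> u \<cdot> (\<gamma> y \<cdot> c) = \<gamma> y \<cdot> c \<cdot> \<gamma> u"
    if "u \<in> X" "u \<sim> y" "c \<in> carrier G" "\<gamma> u \<cdot> c = c \<cdot> \<gamma> u" for u c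
    using that y gen_commute[OF that(1) y that(2)] by (metis m_assoc gen_closed)
  have comm': "\<gamma> u \<cdot> inv\<^bsub>G\<^esub> \<gamma> x = inv\<^bsub>G\<^esub> \<gamma> x \<cdot> \<gamma> u" if "u \<in> X" "u \<sim> x" for u
    using commute_generate[of "\<gamma> u" "{\<gamma> x}" "inv\<^bsub>G\<^esub> \<gamma> x"] that x gen_commute[OF that(1) x that(2)]
    by (simp add: generate.inv)
  show thesis
  proof (rule dominated_elementary_automorphism[OF x y dom, of "\<gamma> y \<cdot> \<gamma> x" "\<gamma> y \<cdot> inv\<^bsub>G\<^esub> \<gamma> x"])
    show "\<phi> (\<gamma> y \<cdot> \<gamma> x) = \<gamma> y"
      if "\<phi> \<in> hom G G" "\<phi> (\<gamma> x) = \<gamma> x" "\<phi> (\<gamma> y) = \<gamma> y \<cdot> inv\<^bsub>G\<^esub> \<gamma> x" for \<phi>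
      using that x y by (simp add: hom_mult m_assoc)
    show "\<phi> (\<gamma> y \<cdot> inv\<^bsub>G\<^esub> \<gamma> x) = \<gamma> y"
      if "\<phi> \<in> hom G G" "\<phi> (\<gamma> x) = \<gamma> x" "\<phi> (\<gamma> y) = \<gamma> y \<cdot> \<gamma> x" for \<phi>
    proof -
      interpret group_hom G G \<phi>
        using that group_axioms by (simp add: group_hom_def group_hom_axioms_def)
      show ?thesis using that x y by (simp add: m_assoc)
    qed
    show "\<gamma> y \<cdot> \<gamma> x \<in> S {x, y}" "\<gamma> y \<cdot> inv\<^bsub>G\<^esub> \<gamma> x \<in> S {x, y}"
      using gens sub by (simp_all add: subgroup_def)
    fix u assume u: "u \<in> X" "u \<sim> y" "u \<sim> x"
    show "\<gamma> u \<cdot> (\<gamma> y \<cdot> \<gamma> x) = \<gamma> y \<cdot> \<gamma> x \<cdot> \<gamma> u"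
      by (rule comm[OF u(1,2) gen_closed[OF x] gen_commute[OF u(1) x u(3)]])
    show "\<gamma> u \<cdot> (\<gamma> y \<cdot> inv\<^bsub>G\<^esub> \<gamma> x) = \<gamma> y \<cdot> inv\<^bsub>G\<^esub> \<gamma> x \<cdot> \<gamma> u"
      by (rule comm[OF u(1,2) _ comm'[OF u(1,3)]]) (use x in simp)
  qed (use that x y in simp_all)
qed

text \<open>The partial conjugation \<open>y \<mapsto> y\<^sup>x\<close> is not the identity, since \<open>y\<close> is not in the centralizer of the
  nonadjacent vertex \<open>x\<close>.\<close>

lemma dominated_conjugation:
  assumes x: "x \<in> X" and y: "y \<in> X" and dom: "dominates \<Gamma> x y"
  obtains \<kappa> where "\<kappa> \<in> stab \<Gamma> (adm_sets \<Gamma>)" "\<kappa> \<in> Conj \<Gamma>" "\<kappa> (\<gamma> y) \<noteq> \<gamma> y"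
proof -
  have sub: "subgroup (S {x, y}) G" using x y by (intro sub_subgroup) auto
  have gens: "\<gamma> x \<in> S {x, y}" "\<gamma> y \<in> S {x, y}" by (simp_all add: gen_in_sub)
  have comm: "\<gamma> u \<cdot> (\<gamma> y \<triangleleft> c) = (\<gamma> y \<triangleleft> c) \<cdot> \<gamma> u"
    if "u \<in> X" "u \<sim> y" "c \<in> carrier G" "\<gamma> u \<cdot> c = c \<cdot> \<gamma> u" for u c
    using commute_generate[of "\<gamma> u" "{\<gamma> y, c}" "\<gamma> y \<triangleleft> c"] that y gen_commute[OF that(1) y that(2)]
    by (auto simp: conjugate_def intro!: generate.eng intro: generate.incl generate.inv)
  have comm': "\<gamma> u \<cdot> inv\<^bsub>G\<^esub> \<gamma> x = inv\<^bsub>G\<^esub> \<gamma> x \<cdot> \<gamma> u" if "u \<in> X" "u \<sim> x" for u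
    using commute_generate[of "\<gamma> u" "{\<gamma> x}" "inv\<^bsub>G\<^esub> \<gamma> x"] that x gen_commute[OF that(1) x that(2)]
    by (simp add: generate.inv)
  have inv: "\<phi> (\<gamma> y \<triangleleft> c) = \<gamma> y"
    if "\<phi> \<in> hom G G" "\<phi> c = c" "\<phi> (\<gamma> y) = \<gamma> y \<triangleleft> inv\<^bsub>G\<^esub> c" "c \<in> carrier G" for \<phi> c
    using that y hom_conjugate[OF group_axioms group_axioms that(1), of "\<gamma> y" c]
    by (simp add: conjugate_conjugate)
  obtain \<kappa> where \<kappa>: "\<kappa> \<in> stab \<Gamma> (adm_sets \<Gamma>)" "\<kappa> (\<gamma> y) = \<gamma> y \<triangleleft> \<gamma> x"
    "\<And>u. u \<in> X \<Longrightarrow> u \<noteq> y \<Longrightarrow> \<kappa> (\<gamma> u) = \<gamma> u"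
  proof (rule dominated_elementary_automorphism[OF x y dom, of "\<gamma> y \<triangleleft> \<gamma> x" "\<gamma> y \<triangleleft> inv\<^bsub>G\<^esub> \<gamma> x"])
    show "\<phi> (\<gamma> y \<triangleleft> \<gamma> x) = \<gamma> y"
      if "\<phi> \<in> hom G G" "\<phi> (\<gamma> x) = \<gamma> x" "\<phi> (\<gamma> y) = \<gamma> y \<triangleleft> inv\<^bsub>G\<^esub> \<gamma> x" for \<phi>
      using inv that x by simp
    show "\<phi> (\<gamma> y \<triangleleft> inv\<^bsub>G\<^esub> \<gamma> x) = \<gamma> y"
      if "\<phi> \<in> hom G G" "\<phi> (\<gamma> x) = \<gamma> x" "\<phi> (\<gamma> y) = \<gamma> y \<triangleleft> \<gamma> x" for \<phi>
    proof -
      interpret group_hom G G \<phi>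
        using that group_axioms by (simp add: group_hom_def group_hom_axioms_def)
      show ?thesis using inv[of \<phi> "inv\<^bsub>G\<^esub> \<gamma> x"] that x by simp
    qed
    show "\<gamma> y \<triangleleft> \<gamma> x \<in> S {x, y}" "\<gamma> y \<triangleleft> inv\<^bsub>G\<^esub> \<gamma> x \<in> S {x, y}"
      using gens sub by (simp_all add: subgroup_def conjugate_def)
    fix u assume u: "u \<in> X" "u \<sim> y" "u \<sim> x"
    show "\<gamma> u \<cdot> (\<gamma> y \<triangleleft> \<gamma> x) = \<gamma> y \<triangleleft> \<gamma> x \<cdot> \<gamma> u"
      by (rule comm[OF u(1,2) gen_closed[OF x] gen_commute[OF u(1) x u(3)]])
    show "\<gamma> u \<cdot> (\<gamma> y \<triangleleft> inv\<^bsub>G\<^esub> \<gamma> x) = \<gamma> y \<triangleleft> inv\<^bsub>G\<^esub> \<gamma> x \<cdot> \<gamma> u"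
      by (rule comm[OF u(1,2) _ comm'[OF u(1,3)]]) (use x in simp)
  qed (use x y in simp_all)
  have "\<exists>g\<in>carrier G. \<kappa> (\<gamma> u) = \<gamma> u \<triangleleft> g" if u: "u \<in> X" for u
  proof (cases "u = y")
    case True
    then show ?thesis using \<kappa> x by auto
  next
    case False
    then show ?thesis using \<kappa>(3)[OF u] u by (intro bexI[of _ "\<one>\<^bsub>G\<^esub>"]) simp_all
  qed
  then have "\<kappa> \<in> Conj \<Gamma>" using \<kappa> by (simp add: Conj_def stab_def)
  moreover have "\<kappa> (\<gamma> y) \<noteq> \<gamma> y"
  proof
    assume "\<kappa> (\<gamma> y) = \<gamma> y"
    then have "\<gamma> y \<cdot> \<gamma> x = \<gamma> x \<cdot> \<gamma> y" using \<kappa> x y by (simp add: conjugate_eq_iff_commute)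
    then have "\<gamma> y \<in> S (perp \<Gamma> {x})" using centralizer_gen[OF x gen_closed[OF y]] by simp
    then have "y \<in> perp \<Gamma> {x}" using gen_in_sub_iff[OF y, of "perp \<Gamma> {x}"] by (auto simp: perp_iff)
    then show False using dom x y by (auto simp: perp_iff dominates_iff)
  qed
  ultimately show thesis using that \<kappa>(1) by blast
qed

lemma Conj_exponent_sum:
  assumes \<epsilon>: "\<epsilon> \<in> hom G integer_group" and \<phi>: "\<phi> \<in> Conj \<Gamma>" and g: "g \<in> carrier G"
  shows "\<epsilon> (\<phi> g) = \<epsilon> g"
proof -
  have "(\<epsilon> \<circ> \<phi>) g = \<epsilon> g"
  proof (rule hom_eq[OF _ Group.hom_compose[OF auto_hom[OF Conj_auto[OF \<phi>]] \<epsilon>] \<epsilon> order_refl])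
    fix x assume x: "x \<in> X"
    then obtain f where "f \<in> carrier G" "\<phi> (\<gamma> x) = \<gamma> x \<triangleleft> f" using \<phi> by (auto simp: Conj_def)
    then show "(\<epsilon> \<circ> \<phi>) (\<gamma> x) = \<epsilon> (\<gamma> x)"
      using x hom_conjugate[OF group_axioms group_integer_group \<epsilon>, of "\<gamma> x" f]
      by (simp add: conjugate_def[of integer_group])
  qed (use g carrier_eq_sub in auto)
  then show ?thesis by simp
qed

text \<open>The transvection \<open>y \<mapsto> yx\<close> is detected by the exponent sum of \<open>x\<close>: it is 1 on \<open>yx\<close>, whereas every
  product of a conjugating automorphism with an element of \<open>St(\<L>)\<close> sends \<open>y\<close> to an element of exponent sum 0,
  because \<open>x \<notin> cl(y)\<close>.\<close>

lemma dominated_not_product: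
  assumes x: "x \<in> X" and y: "y \<in> X" and dom: "dominates \<Gamma> x y" and N: "N \<subseteq> Conj \<Gamma>"
  shows "N <#>\<^bsub>A\<^esub> stab \<Gamma> (closed_sets \<Gamma>) \<noteq> stab_conj \<Gamma> (adm_sets \<Gamma>)"
proof
  assume prod: "N <#>\<^bsub>A\<^esub> stab \<Gamma> (closed_sets \<Gamma>) = stab_conj \<Gamma> (adm_sets \<Gamma>)"
  obtain \<tau> where \<tau>: "\<tau> \<in> stab \<Gamma> (adm_sets \<Gamma>)" "\<tau> (\<gamma> y) = \<gamma> y \<cdot> \<gamma> x"
    using dominated_transvection[OF x y dom] by blast
  have "\<tau> \<in> N <#>\<^bsub>A\<^esub> stab \<Gamma> (closed_sets \<Gamma>)"
    using stab_subset_stab_conj[OF adm_sets_Pow] \<tau>(1) prod by blast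
  then obtain \<phi> \<alpha> where \<phi>: "\<phi> \<in> Conj \<Gamma>" and \<alpha>: "\<alpha> \<in> stab \<Gamma> (closed_sets \<Gamma>)" and eq: "\<tau> = \<phi> \<otimes>\<^bsub>A\<^esub> \<alpha>"
    using N by (auto simp: set_mult_def)
  obtain \<epsilon> where \<epsilon>: "\<epsilon> \<in> hom G integer_group" "\<And>u. u \<in> X \<Longrightarrow> \<epsilon> (\<gamma> u) = (if u = x then 1 else 0)"
    using exponent_sum[of x] by blast
  have nadj: "\<not> y \<sim> x" using dom x y by (simp add: dominates_iff)
  let ?Y = "cl \<Gamma> {y}"
  have Y: "?Y \<in> closed_sets \<Gamma>" unfolding cl_def by (rule perp_closed) (auto simp: perp_iff)
  have YX: "?Y \<subseteq> X" using Y by (simp add: closed_sets_def)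
  have yY: "y \<in> ?Y" using y subset_cl[of "{y}"] by simp
  have xY: "x \<notin> ?Y"
  proof
    assume "x \<in> ?Y"
    then have "x \<sim> y" using y by (simp add: cl_singleton)
    then show False using nadj adj_sym[of x y] by simp
  qed
  have \<alpha>': "\<alpha> \<in> auto G" "\<alpha> ` S ?Y = S ?Y" using \<alpha> Y by (auto simp: stab_def)
  have "\<alpha> (\<gamma> y) \<in> S ?Y" using \<alpha>'(2) gen_in_sub[OF yY] by blast
  then have "\<epsilon> (\<alpha> (\<gamma> y)) = 0" using exponent_sum_sub[OF \<epsilon> YX xY] by simp
  moreover have "\<epsilon> (\<tau> (\<gamma> y)) = \<epsilon> (\<alpha> (\<gamma> y))"
    unfolding eq using \<alpha>'(1) \<phi> y Conj_auto Conj_exponent_sum[OF \<epsilon>(1) \<phi>] by simp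
  moreover have "\<epsilon> (\<tau> (\<gamma> y)) = 1"
    using \<tau>(2) \<epsilon> x y nadj by (auto simp: hom_mult[OF \<epsilon>(1)])
  ultimately show False by simp
qed

end

section \<open>Graphs without dominated vertices\<close>

locale undominated_graph = pc_graph +
  assumes nodom: "Dom \<Gamma> = {}"
begin

abbreviation c where "c x \<equiv> adm \<Gamma> {x}"

text \<open>A vertex of \<open>\<aa>(x)\<close> that is not in the star of \<open>x\<close> would dominate \<open>x\<close>.\<close>

lemma adm_eq_cl: "x \<in> X \<Longrightarrow> c x = cl \<Gamma> {x}"
proof -
  assume x: "x \<in> X"
  have "z \<sim> x" if z: "z \<in> X" "\<And>u. u \<in> X \<Longrightarrow> u \<sim> x \<Longrightarrow> u \<noteq> x \<Longrightarrow> z \<sim> u" for z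
  proof (rule ccontr)
    assume "\<not> z \<sim> x"
    then have "dominates \<Gamma> z x"
      using x z by (auto simp: dominates_iff adj_sym[of _ z])
    then show False using nodom x z(1) by (auto simp: Dom_def)
  qed
  then show ?thesis using x by (auto simp: adm_singleton cl_singleton)
qed

lemma c_iff: "x \<in> X \<Longrightarrow> z \<in> c x \<longleftrightarrow> z \<in> X \<and> (\<forall>u\<in>X. u \<sim> x \<longrightarrow> z \<sim> u)"
  by (simp add: adm_eq_cl cl_singleton)

lemma c_self: "x \<in> X \<Longrightarrow> x \<in> c x"
  using adj_sym by (simp add: c_iff)

text \<open>Adjacency of \<open>x\<close> and \<open>y\<close> passes to \<open>z \<in> cl(x)\<close> and \<open>y\<close>, and from there to \<open>z\<close> and
  \<open>w \<in> cl(y)\<close>. The case \<open>x = y\<close> says that \<open>cl(x)\<close> is a clique.\<close>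

lemma c_adj:
  assumes "x \<in> X" "y \<in> X" "x \<sim> y" "z \<in> c x" "w \<in> c y"
  shows "z \<sim> w"
proof -
  have "z \<sim> y" using assms adj_sym[of x y] by (simp add: c_iff)
  then have "w \<sim> z" using assms by (simp add: c_iff)
  then show ?thesis using adj_sym by blast
qed

lemma c_clique: "x \<in> X \<Longrightarrow> z \<in> c x \<Longrightarrow> w \<in> c x \<Longrightarrow> z \<sim> w"
  using c_adj[of x x z w] by simp

lemma c_mono:
  assumes "x \<in> X" "z \<in> c x"
  shows "c z \<subseteq> c x"
proof
  fix w assume w: "w \<in> c z"
  have z: "z \<in> X" using assms adm_subset by blast
  have "w \<sim> u" if "u \<in> X" "u \<sim> x" for u
  proof -
    have "z \<sim> u" using assms that by (simp add: c_iff)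
    then have "u \<sim> z" using adj_sym by blast
    then show "w \<sim> u" using w z that by (simp add: c_iff)
  qed
  then show "w \<in> c x" using w z assms by (simp add: c_iff)
qed

lemma c_closed:
  assumes "Y \<in> closed_sets \<Gamma>" "y \<in> Y"
  shows "c y \<subseteq> Y"
proof
  fix z assume z: "z \<in> c y"
  have y: "y \<in> X" and Y: "Y = perp \<Gamma> (perp \<Gamma> Y)" using assms by (auto simp: closed_sets_def cl_def)
  have "z \<sim> u" if "u \<in> perp \<Gamma> Y" for u
    using that z y assms(2) by (simp add: c_iff perp_iff)
  then have "z \<in> perp \<Gamma> (perp \<Gamma> Y)" using z y by (simp add: c_iff perp_iff[of "perp \<Gamma> Y"])
  then show "z \<in> Y" using Y by simp
qed

lemma c_in_adm_sets: "x \<in> X \<Longrightarrow> c x \<in> adm_sets \<Gamma>"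
  by (auto simp: adm_sets_def)

text \<open>A closed set is the union of the admissible sets \<open>\<aa>(y) = cl(y)\<close> of its elements, so its subgroup is generated by
  subgroups that \<open>St(\<K>)\<close> preserves.\<close>

lemma stab_closed_eq_stab_adm: "stab \<Gamma> (closed_sets \<Gamma>) = stab \<Gamma> (adm_sets \<Gamma>)"
proof
  show "stab \<Gamma> (closed_sets \<Gamma>) \<subseteq> stab \<Gamma> (adm_sets \<Gamma>)"
    using adm_sets_closed by (auto simp: stab_def)
  have into: "\<phi> g \<in> S Y" if \<phi>: "\<phi> \<in> stab \<Gamma> (adm_sets \<Gamma>)" and Y: "Y \<in> closed_sets \<Gamma>" and g: "g \<in> S Y"
    for \<phi> Y g
  proof -
    have YX: "Y \<subseteq> X" using Y by (simp add: closed_sets_def)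
    have "\<phi> \<in> hom G G" using \<phi> auto_hom by (simp add: stab_def)
    then show ?thesis
    proof (rule hom_into[OF group_axioms _ YX sub_subgroup[OF YX] _ g])
      fix y assume y: "y \<in> Y"
      then have "y \<in> X" using YX by auto
      then have "\<phi> ` S (c y) = S (c y)" using \<phi> c_in_adm_sets by (simp add: stab_def)
      then have "\<phi> (\<gamma> y) \<in> S (c y)" using gen_in_sub[OF c_self[OF \<open>y \<in> X\<close>]] by blast
      then show "\<phi> (\<gamma> y) \<in> S Y" using sub_mono[OF c_closed[OF Y y]] by blast
    qed
  qed
  show "stab \<Gamma> (adm_sets \<Gamma>) \<subseteq> stab \<Gamma> (closed_sets \<Gamma>)"
  proof
    fix \<phi> assume \<phi>: "\<phi> \<in> stab \<Gamma> (adm_sets \<Gamma>)"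
    then have aut: "\<phi> \<in> auto G" by (simp add: stab_def)
    have inv: "inv\<^bsub>A\<^esub> \<phi> \<in> stab \<Gamma> (adm_sets \<Gamma>)"
      using subgroup.m_inv_closed[OF subgroup_stab[OF adm_sets_Pow] \<phi>] .
    have "\<phi> ` S Y = S Y" if Y: "Y \<in> closed_sets \<Gamma>" for Y
    proof
      show "\<phi> ` S Y \<subseteq> S Y" using into[OF \<phi> Y] by auto
      have YX: "Y \<subseteq> X" using Y by (simp add: closed_sets_def)
      show "S Y \<subseteq> \<phi> ` S Y"
      proof
        fix g assume g: "g \<in> S Y"
        have "g = \<phi> ((inv\<^bsub>A\<^esub> \<phi>) g)" using aut sub_in_carrier[OF YX g] by simp
        then show "g \<in> \<phi> ` S Y" using into[OF inv Y g] by (rule image_eqI)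
      qed
    qed
    then show "\<phi> \<in> stab \<Gamma> (closed_sets \<Gamma>)" using aut by (simp add: stab_def)
  qed
qed

lemma Conj_eq_Conj_N: "Conj \<Gamma> = Conj_N \<Gamma>"
proof
  show "Conj \<Gamma> \<subseteq> Conj_N \<Gamma>"
  proof
    fix \<phi> assume \<phi>: "\<phi> \<in> Conj \<Gamma>"
    have "\<exists>f\<in>carrier G. \<forall>y\<in>c x. \<phi> (\<gamma> y) = \<gamma> y \<triangleleft> f" if x: "x \<in> X" for x
    proof -
      obtain f where "f \<in> carrier G" "\<And>g. g \<in> S (c x) \<Longrightarrow> \<phi> g = g \<triangleleft> f"
        using Conj_on_clique[OF \<phi> adm_subset c_clique[OF x]] by metis
      then show ?thesis using gen_in_sub[of _ "c x"] by (intro bexI[of _ f]) simp_all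
    qed
    then show "\<phi> \<in> Conj_N \<Gamma>" using \<phi> by (simp add: Conj_N_def)
  qed
qed (auto simp: Conj_N_def)

text \<open>Apart from \<open>\<aa>(\<emptyset>) = X\<close>, whose subgroup is the whole of \<open>G\<close>, every admissible set lies in some
  \<open>\<aa>(z)\<close> and hence is a clique.\<close>

lemma Conj_subset_stab_conj: "Conj \<Gamma> \<subseteq> stab_conj \<Gamma> (adm_sets \<Gamma>)"
proof
  fix \<phi> assume \<phi>: "\<phi> \<in> Conj \<Gamma>"
  note aut = Conj_auto[OF \<phi>]
  have "\<exists>f\<in>carrier G. \<phi> ` S Y = S Y \<triangleleft>\<triangleleft> f" if Y: "Y \<in> adm_sets \<Gamma>" for Y
  proof -
    obtain Z where Z: "Z \<subseteq> X" "Y = adm \<Gamma> Z" using Y by (auto simp: adm_sets_def)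
    show ?thesis
    proof (cases "Z = {}")
      case True
      then have "S Y = carrier G" using Z by (simp add: adm_def carrier_eq_sub)
      then show ?thesis
        using bij_betw_imp_surj_on[OF auto_bij[OF aut]] by (intro bexI[of _ "\<one>\<^bsub>G\<^esub>"]) simp_all
    next
      case False
      then obtain z where z: "z \<in> Z" "z \<in> X" using Z by auto
      have "Y \<subseteq> c z" using Z z by (auto simp: adm_def)
      then have "y \<sim> w" if "y \<in> Y" "w \<in> Y" for y w using c_clique[OF z(2)] that by blast
      moreover have "Y \<subseteq> X" using Z adm_subset by simp
      ultimately obtain e where "e \<in> carrier G" "\<And>g. g \<in> S Y \<Longrightarrow> \<phi> g = g \<triangleleft> e"
        using Conj_on_clique[OF \<phi>, of Y] by metis
      then show ?thesis by (intro bexI[of _ e]) (simp_all add: conjugate_set_def)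
    qed
  qed
  then show "\<phi> \<in> stab_conj \<Gamma> (adm_sets \<Gamma>)" using aut by (simp add: stab_conj_def)
qed

lemma stab_conj_cE:
  assumes "\<psi> \<in> stab_conj \<Gamma> (adm_sets \<Gamma>)" "x \<in> X"
  obtains f where "f \<in> carrier G" "\<psi> ` S (c x) = S (c x) \<triangleleft>\<triangleleft> f"
  using assms(1) c_in_adm_sets[OF assms(2)] that unfolding stab_conj_def by blast

text \<open>The automorphism \<open>\<psi>\<^sup>-\<^sup>1\<close> sends \<open>x\<close> to a conjugate of an element of \<open>G(\<aa>(x))\<close>. There
  \<open>\<phi>\<close> acts as a conjugation, so \<open>\<phi>\<close> maps \<open>\<psi>\<^sup>-\<^sup>1(x)\<close> to one of its conjugates; now apply \<open>\<psi>\<close>.\<close>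

lemma Conj_normalized:
  assumes \<psi>: "\<psi> \<in> stab_conj \<Gamma> (adm_sets \<Gamma>)" and \<phi>: "\<phi> \<in> Conj \<Gamma>"
  shows "\<psi> \<otimes>\<^bsub>A\<^esub> \<phi> \<otimes>\<^bsub>A\<^esub> inv\<^bsub>A\<^esub> \<psi> \<in> Conj \<Gamma>"
proof -
  have aut: "\<psi> \<in> auto G" using \<psi> by (simp add: stab_conj_def)
  note aut' = Conj_auto[OF \<phi>]
  let ?i = "inv\<^bsub>A\<^esub> \<psi>"
  have i: "?i \<in> stab_conj \<Gamma> (adm_sets \<Gamma>)"
    using subgroup.m_inv_closed[OF subgroup_stab_conj[OF adm_sets_Pow] \<psi>] .
  have "\<exists>g\<in>carrier G. (\<psi> \<otimes>\<^bsub>A\<^esub> \<phi> \<otimes>\<^bsub>A\<^esub> ?i) (\<gamma> x) = \<gamma> x \<triangleleft> g" if x: "x \<in> X" for x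
  proof -
    obtain f where f: "f \<in> carrier G" "?i ` S (c x) = S (c x) \<triangleleft>\<triangleleft> f" using stab_conj_cE[OF i x] .
    have "?i (\<gamma> x) \<in> S (c x) \<triangleleft>\<triangleleft> f" using f(2) gen_in_sub[OF c_self[OF x]] by blast
    then obtain w where w: "w \<in> S (c x)" "?i (\<gamma> x) = w \<triangleleft> f" by (auto simp: conjugate_set_def)
    have wG: "w \<in> carrier G" using sub_in_carrier[OF adm_subset w(1)] .
    obtain e where e: "e \<in> carrier G" "\<phi> w = w \<triangleleft> e"
      using Conj_on_clique[OF \<phi> adm_subset c_clique[OF x]] w(1) by metis
    \<comment> \<open>This element satisfies \<open>\<phi> (w\<^sup>f) = w\<^bsup>e \<phi>(f)\<^esup> = (w\<^sup>f)\<^bsup>d\<^esup>\<close>.\<close>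
    let ?d = "inv\<^bsub>G\<^esub> f \<cdot> (e \<cdot> \<phi> f)"
    have d: "?d \<in> carrier G" using e f aut' by simp
    have "\<phi> (?i (\<gamma> x)) = ?i (\<gamma> x) \<triangleleft> ?d"
      using w wG e f aut' by (simp add: auto_conjugate conjugate_conjugate)
    then have "\<psi> (\<phi> (?i (\<gamma> x))) = \<gamma> x \<triangleleft> \<psi> ?d"
      using auto_conjugate[OF aut _ d, of "?i (\<gamma> x)"] aut x by simp
    then show ?thesis using aut aut' x d by (intro bexI[of _ "\<psi> ?d"]) simp_all
  qed
  then show ?thesis using aut aut' by (simp add: Conj_def)
qed

text \<open>If \<open>\<phi>(x) = x\<^sup>g\<close> lies in the abelian group \<open>G(\<aa>(x))\<close>, it equals \<open>x\<close>.\<close>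

lemma Conj_Int_stab: "Conj \<Gamma> \<inter> stab \<Gamma> (adm_sets \<Gamma>) = {\<one>\<^bsub>A\<^esub>}"
proof
  show "{\<one>\<^bsub>A\<^esub>} \<subseteq> Conj \<Gamma> \<inter> stab \<Gamma> (adm_sets \<Gamma>)"
    using subgroup.one_closed[OF subgroup_Conj] subgroup.one_closed[OF subgroup_stab[OF adm_sets_Pow]]
    by simp
  show "Conj \<Gamma> \<inter> stab \<Gamma> (adm_sets \<Gamma>) \<subseteq> {\<one>\<^bsub>A\<^esub>}"
  proof clarify
    fix \<phi> assume \<phi>: "\<phi> \<in> Conj \<Gamma>" "\<phi> \<in> stab \<Gamma> (adm_sets \<Gamma>)"
    show "\<phi> = \<one>\<^bsub>A\<^esub>"
    proof (rule auto_eqI)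
      fix x assume x: "x \<in> X"
      obtain g where g: "g \<in> carrier G" "\<phi> (\<gamma> x) = \<gamma> x \<triangleleft> g" using \<phi>(1) x by (auto simp: Conj_def)
      note xc = gen_in_sub[OF c_self[OF x]]
      have "\<phi> ` S (c x) = S (c x)" using \<phi>(2) c_in_adm_sets[OF x] by (simp add: stab_def)
      then have "\<gamma> x \<triangleleft> g \<in> S (c x)" using g(2) xc by (metis imageI)
      from conjugate_in_clique[OF adm_subset c_clique[OF x] xc g(1) this]
      show "\<phi> (\<gamma> x) = \<one>\<^bsub>A\<^esub> (\<gamma> x)" using g x by simp
    qed (use Conj_auto[OF \<phi>(1)] in simp_all)
  qed
qed

text \<open>Let \<open>\<psi>\<close> map \<open>G(\<aa>(x))\<close> onto \<open>G(\<aa>(x))\<^bsup>f x\<^esup>\<close>, and let \<open>a x\<close> be \<open>\<psi>\<close> followed by conjugation with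
  \<open>(f x)\<^sup>-\<^sup>1\<close>, a bijection of \<open>G(\<aa>(x))\<close>. The local maps \<open>a x\<close> agree where they overlap, so they glue
  to an endomorphism \<open>h\<close> of \<open>G\<close>; the inverses of the \<open>a x\<close> glue in the same way to an endomorphism \<open>k\<close>,
  and \<open>h\<close> is the required automorphism in \<open>St(\<K>)\<close>. Products in the automorphism group compose from right to left.\<close>

lemma stab_conj_factor:
  assumes \<psi>: "\<psi> \<in> stab_conj \<Gamma> (adm_sets \<Gamma>)"
  obtains \<phi> \<alpha> where "\<phi> \<in> Conj \<Gamma>" "\<alpha> \<in> stab \<Gamma> (adm_sets \<Gamma>)" "\<psi> = \<phi> \<otimes>\<^bsub>A\<^esub> \<alpha>"
proof -
  have aut: "\<psi> \<in> auto G" using \<psi> by (simp add: stab_conj_def)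
  have "\<forall>x\<in>X. \<exists>f. f \<in> carrier G \<and> \<psi> ` S (c x) = S (c x) \<triangleleft>\<triangleleft> f"
    using stab_conj_cE[OF \<psi>] by metis
  then obtain f where f: "\<And>x. x \<in> X \<Longrightarrow> f x \<in> carrier G"
    and \<psi>f: "\<And>x. x \<in> X \<Longrightarrow> \<psi> ` S (c x) = S (c x) \<triangleleft>\<triangleleft> f x" by metis
  define a where "a x g = \<psi> g \<triangleleft> inv\<^bsub>G\<^esub> (f x)" for x g
  have carr: "g \<in> carrier G" if "g \<in> S (c x)" for g x using sub_in_carrier[OF adm_subset that] .
  have a_closed: "a x g \<in> carrier G" if "x \<in> X" "g \<in> carrier G" for x g
    using that f aut by (simp add: a_def)
  have a_hom: "a x \<in> hom G G" if "x \<in> X" for x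
    using Group.hom_compose[OF auto_hom[OF aut] conjugate_hom[of "inv\<^bsub>G\<^esub> (f x)"]] f that
    by (simp add: a_def[abs_def] comp_def)
  have a_into: "a x g \<in> S (c x)" if x: "x \<in> X" and g: "g \<in> S (c x)" for x g
  proof -
    have "\<psi> g \<in> S (c x) \<triangleleft>\<triangleleft> f x" using \<psi>f[OF x] g by blast
    then obtain w where w: "w \<in> S (c x)" "\<psi> g = w \<triangleleft> f x" by (auto simp: conjugate_set_def)
    then have "a x g = w" using carr[of w x] f x by (simp add: a_def conjugate_conjugate)
    then show ?thesis using w by simp
  qed
  have a_onto: "\<exists>g\<in>S (c x). a x g = w" if x: "x \<in> X" and w: "w \<in> S (c x)" for x w
  proof -
    have "w \<triangleleft> f x \<in> \<psi> ` S (c x)" using \<psi>f[OF x] w by (auto simp: conjugate_set_def)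
    then obtain g where "g \<in> S (c x)" "\<psi> g = w \<triangleleft> f x" by auto
    then show ?thesis using carr[OF w] f x by (intro bexI[of _ g]) (simp_all add: a_def conjugate_conjugate)
  qed
  have a_inj: "g = h" if "x \<in> X" "g \<in> S (c x)" "h \<in> S (c x)" "a x g = a x h" for x g h
  proof -
    have "\<psi> g = \<psi> h"
      by (rule conjugate_inj[of _ "inv\<^bsub>G\<^esub> (f x)"]) (use that f carr aut in \<open>simp_all add: a_def\<close>)
    then have "(inv\<^bsub>A\<^esub> \<psi>) (\<psi> g) = (inv\<^bsub>A\<^esub> \<psi>) (\<psi> h)" by simp
    then show ?thesis using aut that carr by simp
  qed
  \<comment> \<open>If \<open>z \<in> \<aa>(x)\<close>, then \<open>a z g\<close> and \<open>a x g\<close> are conjugate elements of the abelian group \<open>G(\<aa>(x))\<close>, hence equal.\<close>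
  have a_consistent: "a z g = a x g" if x: "x \<in> X" and z: "z \<in> c x" and g: "g \<in> S (c z)" for x z g
  proof -
    have zX: "z \<in> X" using z adm_subset by blast
    have sub: "S (c z) \<subseteq> S (c x)" using sub_mono[OF c_mono[OF x z]] .
    let ?u = "a z g" and ?e = "f z \<cdot> inv\<^bsub>G\<^esub> (f x)"
    have u: "?u \<in> S (c x)" using a_into[OF zX g] sub by blast
    have e: "?e \<in> carrier G" using f x zX by simp
    have "a x g = ?u \<triangleleft> ?e"
      using f x zX aut carr[OF g] by (simp add: a_def conjugate_conjugate)
    moreover from this have "?u \<triangleleft> ?e \<in> S (c x)" using a_into[OF x subsetD[OF sub g]] by simp
    from conjugate_in_clique[OF adm_subset c_clique[OF x] u e this]
    have "?u \<triangleleft> ?e = ?u" .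
    ultimately show ?thesis by simp
  qed
  have commute: "g \<cdot> h = h \<cdot> g" if "x \<in> X" "y \<in> X" "x \<sim> y" "g \<in> S (c x)" "h \<in> S (c y)" for x y g h
    using sub_commute[OF adm_subset adm_subset c_adj[OF that(1-3)] that(4,5)] .
  have xc: "\<gamma> x \<in> S (c x)" if "x \<in> X" for x using gen_in_sub[OF c_self[OF that]] .
  have a_commute: "a x (\<gamma> x) \<cdot> a y (\<gamma> y) = a y (\<gamma> y) \<cdot> a x (\<gamma> x)" if "x \<in> X" "y \<in> X" "x \<sim> y" for x y
    using commute[OF that a_into[OF that(1) xc] a_into[OF that(2) xc]] that by simp
  obtain h where h: "h \<in> hom G G" "\<And>x. x \<in> X \<Longrightarrow> h (\<gamma> x) = a x (\<gamma> x)"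
    by (rule hom_exists[OF group_axioms, of "\<lambda>x. a x (\<gamma> x)"]) (use a_closed a_commute in simp_all)
  have ha: "h g = a x g" if x: "x \<in> X" and g: "g \<in> S (c x)" for x g
  proof (rule hom_eq[OF group_axioms h(1) a_hom[OF x] adm_subset _ g])
    fix z assume z: "z \<in> c x"
    then have "z \<in> X" using adm_subset by blast
    then show "h (\<gamma> z) = a x (\<gamma> z)" using h(2) a_consistent[OF x z xc] by simp
  qed
  \<comment> \<open>The element \<open>b x\<close> is the preimage of the generator \<open>x\<close> under the local map \<open>a x\<close>.\<close>
  have "\<forall>x\<in>X. \<exists>b. b \<in> S (c x) \<and> a x b = \<gamma> x" using a_onto xc by metis
  then obtain b where b: "\<And>x. x \<in> X \<Longrightarrow> b x \<in> S (c x)" "\<And>x. x \<in> X \<Longrightarrow> a x (b x) = \<gamma> x" by metis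
  have b_commute: "b x \<cdot> b y = b y \<cdot> b x" if "x \<in> X" "y \<in> X" "x \<sim> y" for x y
    using commute[OF that b(1)[OF that(1)] b(1)[OF that(2)]] .
  obtain k where k: "k \<in> hom G G" "\<And>x. x \<in> X \<Longrightarrow> k (\<gamma> x) = b x"
    by (rule hom_exists[OF group_axioms, of b]) (use b_commute carr[OF b(1)] in simp_all)
  have hk: "h (k (\<gamma> x)) = \<gamma> x" if x: "x \<in> X" for x using k(2) ha[OF x b(1)] b(2) x by simp
  have k_into: "k g \<in> S (c x)" if x: "x \<in> X" and g: "g \<in> S (c x)" for x g
  proof (rule hom_into[OF group_axioms k(1) adm_subset sub_subgroup[OF adm_subset] _ g])
    fix z assume z: "z \<in> c x"
    then have "z \<in> X" using adm_subset by blast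
    then show "k (\<gamma> z) \<in> S (c x)" using k(2) b(1) sub_mono[OF c_mono[OF x z]] by auto
  qed
  \<comment> \<open>Both sides lie in \<open>G(\<aa>(x))\<close> and have the same image under the injective map \<open>a x\<close>.\<close>
  have kh: "k (h (\<gamma> x)) = \<gamma> x" if x: "x \<in> X" for x
  proof (rule a_inj[OF x _ xc[OF x]])
    have hx: "h (\<gamma> x) \<in> S (c x)" using h(2)[OF x] a_into[OF x xc[OF x]] by simp
    show "k (h (\<gamma> x)) \<in> S (c x)" using k_into[OF x hx] .
    have hkid: "h (k g) = g" if "g \<in> carrier G" for g
    proof -
      have "(\<lambda>g. g) \<in> hom G G" by (simp add: hom_def)
      from hom_eq[OF group_axioms Group.hom_compose[OF k(1) h(1)] this order_refl] hk that carrier_eq_sub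
      show ?thesis by simp
    qed
    have "a x (k (h (\<gamma> x))) = h (k (h (\<gamma> x)))" using ha[OF x k_into[OF x hx]] by simp
    also have "\<dots> = h (\<gamma> x)" using hkid carr[OF hx] by simp
    also have "\<dots> = a x (\<gamma> x)" using h(2) x .
    finally show "a x (k (h (\<gamma> x))) = a x (\<gamma> x)" .
  qed
  define \<alpha> where "\<alpha> = restrict h (carrier G)"
  note aut_\<alpha> = auto_from_inverse_homs[OF h(1) k(1) hk kh, folded \<alpha>_def]
  have "\<alpha> ` S Y = S Y" if Y: "Y \<in> closed_sets \<Gamma>" for Y
  proof (rule aut_\<alpha>(2))
    show YX: "Y \<subseteq> X" using Y by (simp add: closed_sets_def)
    fix y assume y: "y \<in> Y"
    then have yX: "y \<in> X" using YX by auto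
    have "S (c y) \<subseteq> S Y" using sub_mono[OF c_closed[OF Y y]] .
    then show "h (\<gamma> y) \<in> S Y \<and> k (\<gamma> y) \<in> S Y"
      using h(2)[OF yX] k(2)[OF yX] a_into[OF yX xc[OF yX]] b(1)[OF yX] by auto
  qed
  then have \<alpha>: "\<alpha> \<in> stab \<Gamma> (adm_sets \<Gamma>)"
    using aut_\<alpha>(1) adm_sets_closed by (simp add: stab_def subset_iff)
  let ?\<phi> = "\<psi> \<otimes>\<^bsub>A\<^esub> inv\<^bsub>A\<^esub> \<alpha>"
  have inv_\<alpha>: "(inv\<^bsub>A\<^esub> \<alpha>) (\<gamma> x) = b x" if x: "x \<in> X" for x
  proof -
    have "\<alpha> (b x) = \<gamma> x" using ha[OF x b(1)[OF x]] b[OF x] carr[OF b(1)[OF x]] by (simp add: \<alpha>_def)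
    then show ?thesis using A_inv_apply(2)[OF aut_\<alpha>(1) carr[OF b(1)[OF x]]] by simp
  qed
  \<comment> \<open>By the choice of \<open>b x\<close>, the automorphism \<open>\<psi>\<close> maps it to the conjugate of \<open>x\<close> by \<open>f x\<close>.\<close>
  have "\<exists>g\<in>carrier G. ?\<phi> (\<gamma> x) = \<gamma> x \<triangleleft> g" if x: "x \<in> X" for x
  proof -
    have "\<gamma> x \<triangleleft> f x = a x (b x) \<triangleleft> f x" using b x by simp
    also have "\<dots> = \<psi> (b x)"
      using f[OF x] aut carr[OF b(1)[OF x]] by (simp add: a_def conjugate_conjugate)
    also have "\<dots> = ?\<phi> (\<gamma> x)" using aut aut_\<alpha>(1) x inv_\<alpha> by simp
    finally show ?thesis using f[OF x] by (intro bexI[of _ "f x"]) simp_all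
  qed
  then have "?\<phi> \<in> Conj \<Gamma>" using aut aut_\<alpha>(1) by (simp add: Conj_def)
  moreover have "\<psi> = ?\<phi> \<otimes>\<^bsub>A\<^esub> \<alpha>"
    using aut aut_\<alpha>(1) by (intro auto_eqI) simp_all
  ultimately show thesis using that \<alpha> by blast
qed

theorem semidirect_Conj_stab:
  "is_semidirect A (stab_conj \<Gamma> (adm_sets \<Gamma>)) (Conj \<Gamma>) (stab \<Gamma> (adm_sets \<Gamma>))"
proof -
  let ?S = "stab_conj \<Gamma> (adm_sets \<Gamma>)" and ?H = "stab \<Gamma> (adm_sets \<Gamma>)"
  interpret A: group A by (rule A_group)
  have S: "subgroup ?S A" by (rule subgroup_stab_conj[OF adm_sets_Pow])
  have H: "subgroup ?H A" by (rule subgroup_stab[OF adm_sets_Pow])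
  have HS: "?H \<subseteq> ?S" by (rule stab_subset_stab_conj[OF adm_sets_Pow])
  have "Conj \<Gamma> \<lhd> A\<lparr>carrier := ?S\<rparr>"
  proof -
    interpret AS: group "A\<lparr>carrier := ?S\<rparr>" by (rule subgroup.subgroup_is_group[OF S A_group])
    have "subgroup (Conj \<Gamma>) (A\<lparr>carrier := ?S\<rparr>)"
      by (rule A.subgroup_incl[OF subgroup_Conj S Conj_subset_stab_conj])
    then show ?thesis
      using Conj_normalized A.m_inv_consistent[OF S] by (simp add: AS.normal_inv_iff)
  qed
  moreover have "subgroup ?H (A\<lparr>carrier := ?S\<rparr>)"
    by (rule A.subgroup_incl[OF H S HS])
  moreover have "Conj \<Gamma> <#>\<^bsub>A\<^esub> ?H = ?S"
  proof
    show "Conj \<Gamma> <#>\<^bsub>A\<^esub> ?H \<subseteq> ?S"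
      using subgroup.m_closed[OF S] Conj_subset_stab_conj HS by (auto simp: set_mult_def)
    show "?S \<subseteq> Conj \<Gamma> <#>\<^bsub>A\<^esub> ?H"
    proof
      fix \<psi> assume "\<psi> \<in> ?S"
      then obtain \<phi> \<alpha> where "\<phi> \<in> Conj \<Gamma>" "\<alpha> \<in> ?H" "\<psi> = \<phi> \<otimes>\<^bsub>A\<^esub> \<alpha>" by (rule stab_conj_factor)
      then show "\<psi> \<in> Conj \<Gamma> <#>\<^bsub>A\<^esub> ?H" unfolding set_mult_def by blast
    qed
  qed
  ultimately show ?thesis using S Conj_Int_stab by (simp add: is_semidirect_def)
qed

end

theorem theorem4p10:
  fixes \<Gamma> :: "'a pair_pre_digraph"
  assumes "pair_graph \<Gamma>"
  shows "(Dom \<Gamma> = {} \<longleftrightarrow>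
            is_semidirect (AutoGroup (pc_group \<Gamma>)) (stab_conj \<Gamma> (adm_sets \<Gamma>))
              (Conj_N \<Gamma>) (stab \<Gamma> (closed_sets \<Gamma>))) \<and>
         (Dom \<Gamma> = {} \<longleftrightarrow>
            is_semidirect (AutoGroup (pc_group \<Gamma>)) (stab_conj \<Gamma> (adm_sets \<Gamma>))
              (Conj \<Gamma>) (stab \<Gamma> (closed_sets \<Gamma>))) \<and>
         (Dom \<Gamma> = {} \<longleftrightarrow>
            is_semidirect (AutoGroup (pc_group \<Gamma>)) (stab_conj \<Gamma> (adm_sets \<Gamma>))
              (Conj \<Gamma>) (stab \<Gamma> (adm_sets \<Gamma>)))"
proof -
  interpret pc_graph \<Gamma> by (rule pc_graph.intro) fact
  show ?thesis
  proof (cases "Dom \<Gamma> = {}")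
    case True
    then interpret undominated_graph \<Gamma> by unfold_locales
    show ?thesis
      using True semidirect_Conj_stab
      by (simp add: stab_closed_eq_stab_adm Conj_eq_Conj_N[symmetric])
  next
    case False
    then obtain x y where xy: "x \<in> X" "y \<in> X" "dominates \<Gamma> x y" by (auto simp: Dom_def)
    have "Conj_N \<Gamma> \<subseteq> Conj \<Gamma>" by (auto simp: Conj_N_def)
    then have "\<not> is_semidirect A (stab_conj \<Gamma> (adm_sets \<Gamma>)) (Conj_N \<Gamma>) (stab \<Gamma> (closed_sets \<Gamma>))"
      "\<not> is_semidirect A (stab_conj \<Gamma> (adm_sets \<Gamma>)) (Conj \<Gamma>) (stab \<Gamma> (closed_sets \<Gamma>))"
      using dominated_not_product[OF xy] by (auto simp: is_semidirect_def)
    moreover have "\<not> is_semidirect A (stab_conj \<Gamma> (adm_sets \<Gamma>)) (Conj \<Gamma>) (stab \<Gamma> (adm_sets \<Gamma>))"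
    proof
      assume "is_semidirect A (stab_conj \<Gamma> (adm_sets \<Gamma>)) (Conj \<Gamma>) (stab \<Gamma> (adm_sets \<Gamma>))"
      then have int: "Conj \<Gamma> \<inter> stab \<Gamma> (adm_sets \<Gamma>) = {\<one>\<^bsub>A\<^esub>}" by (simp add: is_semidirect_def)
      obtain \<kappa> where \<kappa>: "\<kappa> \<in> stab \<Gamma> (adm_sets \<Gamma>)" "\<kappa> \<in> Conj \<Gamma>" "\<kappa> (\<gamma> y) \<noteq> \<gamma> y"
        using dominated_conjugation[OF xy] .
      then have "\<kappa> = \<one>\<^bsub>A\<^esub>" using int by blast
      then show False using \<kappa>(3) xy(2) by simp
    qed
    ultimately show ?thesis using False by blast
  qed
qed

end
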